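(* Let $K$ be a field and $\mathcal O$ a finite order ideal of terms in $K[x_1,\dots,x_n]$. Let $\mathfrak B\subset K[C]$ be the ideal defining the border marked scheme of $\mathcal O$ and $\mathfrak P\subset K[C\setminus\tilde C]$ be the ideal defining the Pommaret marked scheme of $\mathcal O$. Then $$\mathfrak P=\mathfrak B\cap K[C\setminus\tilde C].$$
   Context: $\mathbb T$ is the set of terms (monic monomials) in the variables $x_1<\dots<x_n$. For a term $\tau\ne1$, $\min(\tau)$ is the smallest variable dividing $\tau$. An order ideal is a (nonempty) set of terms closed under taking divisors. For a finite order ideal $\mathcal O=\{\sigma_1,\dots,\sigma_\ell\}$, the border is $\partial\mathcal O=\{x_i\tau:\tau\in\mathcal O,\ 1\le i\le n\}\setminus\mathcal O$. Write $\partial\mathcal O=\{\tau_1,\dots,\tau_m\}$, ordered increasingly by degree (terms of equal degree arbitrarily). The Pommaret basis $\mathcal P_{\mathcal O}\subseteq\partial\mathcal O$ is the set of terms $\sigma$ in the ideal $J$ generated by $\mathbb T\setminus\mathcal O$ with $\sigma/\min(\sigma)\notin J$. Generic marked sets: let $C=\{C_{ij}:1\le i\le m,\ 1\le j\le\ell\}$ be new parameters and $b_i=\tau_i-\sum_{j=1}^\ell C_{ij}\sigma_j\in K[C][x_1,\dots,x_n]$, with head term $\mathrm{Ht}(b_i)=\tau_i$. Put $\mathscr B=\{b_1,\dots,b_m\}$ (generic $\partial\mathcal O$-marked set), $\mathscr P=\{b_i:\tau_i\in\mathcal P_{\mathcal O}\}$ (generic $\mathcal P_{\mathcal O}$-marked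 set), and $\tilde C=\{C_{ij}:\tau_i\in\partial\mathcal O\setminus\mathcal P_{\mathcal O}\}$. Multiplicative sets: for the border structure, $\mathcal T_{\tau_i}=\{\mu\in\mathbb T:\tau_j\text{ does not divide }\tau_i\mu\text{ for all }j>i\}$ for $\tau_i\in\partial\mathcal O$; for the Pommaret structure, $\mathcal T_\alpha=\mathbb T\cap K[x_1,\dots,\min(\alpha)]$ for $\alpha\in\mathcal P_{\mathcal O}$. The cone of $\alpha$ is $\{\eta\alpha:\eta\in\mathcal T_\alpha\}$. In each structure, a reduction step replaces a polynomial $g$ by $g-c\,\eta\, b$, where $b$ is in the marked set, $\eta\in\mathcal T_{\mathrm{Ht}(b)}$, and $\eta\,\mathrm{Ht}(b)$ is in the support of $g$ with coefficient $c$. Both reduction relations (finitely many, possibly zero, steps) are Noetherian and confluent, so every polynomial reduces to a unique polynomial supported on $\mathcal O$ (an $\mathcal O$-reduced polynomial). $S(f,f')=\eta f-\eta'f'$, where $\eta\,\mathrm{Ht}(f)=\eta'\,\mathrm{Ht}(f')=\mathrm{lcm}(\mathrm{Ht}(f),\mathrm{Ht}(f'))$. Border marked scheme: a couple $(\alpha,\alpha')$ of border terms is a neighbour couple if $\alpha=x_j\alpha'$ for some $j$ or $x_i\alpha=x_j\alpha'$ for some $i,j$. For each $b_r,b_s\in\mathscr B$ whose head terms form a neighbour couple, let $h_{rs}$ be the $\mathcal O$-reduced polynomial to which $S(b_r,b_s)$ reduces by $\mathscr B$ in the border structure. $\mathfrak B\subset K[C]$ is the ideal generated by all coefficients (with respect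 to the terms in $x_1,\dots,x_n$) of the $h_{rs}$. The border marked scheme is $\mathrm{Spec}(K[C]/\mathfrak B)$. Pommaret marked scheme: a couple $(\alpha,\alpha')$ in $\mathcal P_{\mathcal O}$ is non-multiplicative if there is a variable $x_i\notin\mathcal T_\alpha$ with $x_i\alpha$ in the cone of $\alpha'$ (Pommaret structure). For each $p_r,p_s\in\mathscr P$ whose head terms form a non-multiplicative couple, let $h'_{rs}$ be the $\mathcal O$-reduced polynomial to which $S(p_r,p_s)$ reduces by $\mathscr P$ in the Pommaret structure. $\mathfrak P\subset K[C\setminus\tilde C]$ is the ideal generated by all coefficients (with respect to the terms in $x_1,\dots,x_n$) of the $h'_{rs}$. The Pommaret marked scheme is $\mathrm{Spec}(K[C\setminus\tilde C]/\mathfrak P)$. *)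

theory Defs
  imports "HOL-Library.Poly_Mapping" "HOL-Algebra.Ideal"
begin

text \<open>
  The variables \<open>x\<^sub>1 < \<dots> < x\<^sub>n\<close> are the elements of a finite linearly ordered type. A term is its
  exponent vector, so that multiplication of terms is addition and the term 1 is \<open>0\<close>.
  The order \<open>(\<le>)\<close> on poly mappings provided by the library plays no role.
\<close>

abbreviation "keys \<equiv> Poly_Mapping.keys"
abbreviation "lookup \<equiv> Poly_Mapping.lookup"
abbreviation "single \<equiv> Poly_Mapping.single"

type_synonym 'v monomial = "'v \<Rightarrow>\<^sub>0 nat"
type_synonym ('v, 'a) mpoly = "'v monomial \<Rightarrow>\<^sub>0 'a"

text \<open>The polynomials, with coefficients in a type \<open>'a\<close>, in which only variables from \<open>V\<close> occur.\<close>

definition poly_ring :: "'v set \<Rightarrow> ('v, 'a::comm_ring_1) mpoly ring" where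
  "poly_ring V =
    \<lparr>carrier = {p. \<forall>t\<in>keys p. keys t \<subseteq> V}, mult = (*), one = 1, zero = 0, add = (+)\<rparr>"

lemma cring_poly_ring: "cring (poly_ring V :: ('v, 'a::comm_ring_1) mpoly ring)"
proof -
  let ?A = "{p :: ('v, 'a) mpoly. \<forall>t\<in>keys p. keys t \<subseteq> V}"
  have add_closed: "p + q \<in> ?A" if "p \<in> ?A" "q \<in> ?A" for p q
    using that Poly_Mapping.keys_add[of p q] by blast
  have mult_closed: "p * q \<in> ?A" if p: "p \<in> ?A" and q: "q \<in> ?A" for p q
  proof (rule CollectI, rule ballI)
    fix t assume "t \<in> keys (p * q)"
    then obtain u v where t: "t = u + v" and "u \<in> keys p" "v \<in> keys q"
      using keys_mult[of p q] by blast
    with p q have "keys u \<union> keys v \<subseteq> V" by blast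
    then show "keys t \<subseteq> V"
      unfolding t using Poly_Mapping.keys_add[of u v] by (rule order_trans[rotated])
  qed
  have uminus_closed: "- p \<in> ?A" if "p \<in> ?A" for p
    using that by (simp add: in_keys_iff)
  have one_zero_closed: "1 \<in> ?A" "0 \<in> ?A"
    by simp_all
  have ex_uminus: "\<exists>q\<in>?A. q + p = 0" if "p \<in> ?A" for p
    using uminus_closed[OF that] by (rule bexI[rotated]) (rule left_minus)
  show ?thesis
    unfolding poly_ring_def
  proof (rule cringI)
    show "abelian_group \<lparr>carrier = ?A, mult = (*), one = 1, zero = 0, add = (+)\<rparr>"
      by (rule abelian_groupI; unfold ring_record_simps;
          (rule add.assoc add.commute add_0_left one_zero_closed | erule (1) add_closed | erule ex_uminus))
    show "comm_monoid \<lparr>carrier = ?A, mult = (*), one = 1, zero = 0, add = (+)\<rparr>"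
      by (rule comm_monoidI; unfold monoid_record_simps partial_object.simps;
          (rule mult.assoc mult.commute mult_1_left one_zero_closed | erule (1) mult_closed))
  qed (unfold ring_record_simps, rule distrib_right)
qed


subsection \<open>Terms and order ideals\<close>

definition tvar :: "'v \<Rightarrow> 'v monomial" where
  "tvar v = single v 1"

definition tdeg :: "'v monomial \<Rightarrow> nat" where
  "tdeg t = (\<Sum>v\<in>keys t. lookup t v)"

definition tdvd :: "'v monomial \<Rightarrow> 'v monomial \<Rightarrow> bool" where
  "tdvd s t \<longleftrightarrow> (\<exists>u. t = s + u)"

text \<open>Subtraction of exponents is truncated, so the exponents below are the pointwise maxima.\<close>

definition tlcm :: "'v monomial \<Rightarrow> 'v monomial \<Rightarrow> 'v monomial" where
  "tlcm s t = s + (t - s)"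

lemma lookup_tlcm: "lookup (tlcm s t) v = max (lookup s v) (lookup t v)"
  by (simp add: tlcm_def lookup_add lookup_minus)

text \<open>The smallest variable dividing a term; unspecified on the term 1.\<close>

definition tmin :: "'v::linorder monomial \<Rightarrow> 'v" where
  "tmin t = Min (keys t)"

definition order_ideal :: "'v monomial set \<Rightarrow> bool" where
  "order_ideal \<O> \<longleftrightarrow> \<O> \<noteq> {} \<and> (\<forall>t\<in>\<O>. \<forall>s. tdvd s t \<longrightarrow> s \<in> \<O>)"

definition border :: "'v monomial set \<Rightarrow> 'v monomial set" where
  "border \<O> = {tvar v + t | v t. t \<in> \<O>} - \<O>"

definition complement_ideal :: "'v monomial set \<Rightarrow> ('v, 'k::field) mpoly set" where
  "complement_ideal \<O> = Idl\<^bsub>poly_ring UNIV\<^esub> {single t 1 | t. t \<notin> \<O>}"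

text \<open>
  The type argument is the base field over which the ideal \<open>J\<close> generated by the terms outside
  \<open>\<O>\<close> is formed. The quotient by the smallest variable is a truncated subtraction of exponents,
  which is exact because the term 1 is not in \<open>J\<close>.
\<close>

definition pommaret_basis ::
    "'k::field itself \<Rightarrow> 'v::linorder monomial set \<Rightarrow> 'v monomial set" where
  "pommaret_basis K \<O> =
    (let J = complement_ideal \<O> :: ('v, 'k) mpoly set
     in {t. single t 1 \<in> J \<and> single (t - tvar (tmin t)) 1 \<notin> J})"


subsection \<open>Marked sets and reduction\<close>

text \<open>
  The head terms \<open>\<tau> i\<close> are indexed by \<open>{1..m}\<close> and the terms \<open>\<sigma> j\<close> of the order ideal by
  \<open>{1..l}\<close>; the parameter \<open>C\<^sub>i\<^sub>j\<close> is the variable \<open>(i, j)\<close>. The parameter ring is the set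
  \<open>carrier (poly_ring (parameters m l))\<close> inside the polynomials in all variables of type
  \<open>nat \<times> nat\<close>.
\<close>

type_synonym 'k param_poly = "(nat \<times> nat, 'k) mpoly"

definition parameters :: "nat \<Rightarrow> nat \<Rightarrow> (nat \<times> nat) set" where
  "parameters m l = {1..m} \<times> {1..l}"

definition generic_marked ::
    "nat \<Rightarrow> (nat \<Rightarrow> 'v monomial) \<Rightarrow> (nat \<Rightarrow> 'v monomial) \<Rightarrow> nat
      \<Rightarrow> ('v, 'k::field param_poly) mpoly" where
  "generic_marked l \<sigma> \<tau> i =
    single (\<tau> i) 1
      - (\<Sum>j=1..l. single (\<sigma> j) (single (tvar (i, j)) 1))"

text \<open>
  A reduction structure consists of an index set \<open>I\<close>, head terms \<open>ht\<close>, multiplicative sets \<open>T\<close>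
  and marked polynomials \<open>b\<close>.
\<close>

definition reduction_step ::
    "nat set \<Rightarrow> (nat \<Rightarrow> 'v monomial) \<Rightarrow> (nat \<Rightarrow> 'v monomial set)
      \<Rightarrow> (nat \<Rightarrow> ('v, 'a::comm_ring_1) mpoly) \<Rightarrow> ('v, 'a) mpoly \<Rightarrow> ('v, 'a) mpoly \<Rightarrow> bool" where
  "reduction_step I ht T b g g' \<longleftrightarrow>
    (\<exists>i\<in>I. \<exists>\<eta>\<in>T i. \<eta> + ht i \<in> keys g \<and>
       g' = g - single \<eta> (lookup g (\<eta> + ht i)) * b i)"

text \<open>Well defined when the reduction relation is Noetherian and confluent.\<close>

definition reduced_form ::
    "'v monomial set \<Rightarrow> nat set \<Rightarrow> (nat \<Rightarrow> 'v monomial) \<Rightarrow> (nat \<Rightarrow> 'v monomial set)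
      \<Rightarrow> (nat \<Rightarrow> ('v, 'a::comm_ring_1) mpoly) \<Rightarrow> ('v, 'a) mpoly \<Rightarrow> ('v, 'a) mpoly" where
  "reduced_form \<O> I ht T b g = (THE h. (reduction_step I ht T b)\<^sup>*\<^sup>* g h \<and> keys h \<subseteq> \<O>)"

definition S_poly ::
    "(nat \<Rightarrow> 'v monomial) \<Rightarrow> (nat \<Rightarrow> ('v, 'a::comm_ring_1) mpoly) \<Rightarrow> nat \<Rightarrow> nat \<Rightarrow> ('v, 'a) mpoly"
  where
  "S_poly ht b r s =
    single (tlcm (ht r) (ht s) - ht r) 1 * b r
      - single (tlcm (ht r) (ht s) - ht s) 1 * b s"


subsection \<open>The border marked scheme\<close>

definition border_mult :: "nat \<Rightarrow> (nat \<Rightarrow> 'v monomial) \<Rightarrow> nat \<Rightarrow> 'v monomial set" where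
  "border_mult m \<tau> i = {\<mu>. \<forall>j\<in>{i<..m}. \<not> tdvd (\<tau> j) (\<tau> i + \<mu>)}"

definition neighbour_couple :: "'v monomial \<Rightarrow> 'v monomial \<Rightarrow> bool" where
  "neighbour_couple \<alpha> \<alpha>' \<longleftrightarrow>
    (\<exists>v. \<alpha> = tvar v + \<alpha>') \<or> (\<exists>u v. tvar u + \<alpha> = tvar v + \<alpha>')"

definition border_scheme_ideal ::
    "'v monomial set \<Rightarrow> nat \<Rightarrow> (nat \<Rightarrow> 'v monomial) \<Rightarrow> nat \<Rightarrow> (nat \<Rightarrow> 'v monomial)
      \<Rightarrow> 'k::field param_poly set" where
  "border_scheme_ideal \<O> l \<sigma> m \<tau> =
    Idl\<^bsub>poly_ring (parameters m l)\<^esub>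
      (\<Union>(r, s) \<in> {(r, s). r \<in> {1..m} \<and> s \<in> {1..m} \<and> neighbour_couple (\<tau> r) (\<tau> s)}.
         Poly_Mapping.range
           (reduced_form \<O> {1..m} \<tau> (border_mult m \<tau>) (generic_marked l \<sigma> \<tau>)
             (S_poly \<tau> (generic_marked l \<sigma> \<tau>) r s)))"


subsection \<open>The Pommaret marked scheme\<close>

definition pommaret_mult :: "'v::linorder monomial \<Rightarrow> 'v monomial set" where
  "pommaret_mult \<alpha> = {\<mu>. \<forall>v\<in>keys \<mu>. v \<le> tmin \<alpha>}"

definition pommaret_cone :: "'v::linorder monomial \<Rightarrow> 'v monomial set" where
  "pommaret_cone \<alpha> = {\<eta> + \<alpha> | \<eta>. \<eta> \<in> pommaret_mult \<alpha>}"

definition nonmultiplicative_couple :: "'v::linorder monomial \<Rightarrow> 'v monomial \<Rightarrow> bool" where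
  "nonmultiplicative_couple \<alpha> \<alpha>' \<longleftrightarrow>
    (\<exists>v. tvar v \<notin> pommaret_mult \<alpha> \<and> tvar v + \<alpha> \<in> pommaret_cone \<alpha>')"

definition pommaret_indices ::
    "'k::field itself \<Rightarrow> 'v::linorder monomial set \<Rightarrow> nat \<Rightarrow> (nat \<Rightarrow> 'v monomial) \<Rightarrow> nat set" where
  "pommaret_indices K \<O> m \<tau> = {i\<in>{1..m}. \<tau> i \<in> pommaret_basis K \<O>}"

text \<open>The set of parameters written \<open>C\<close> with a tilde in the literature.\<close>

definition nonpommaret_parameters ::
    "'k::field itself \<Rightarrow> 'v::linorder monomial set \<Rightarrow> nat \<Rightarrow> nat \<Rightarrow> (nat \<Rightarrow> 'v monomial)
      \<Rightarrow> (nat \<times> nat) set" where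
  "nonpommaret_parameters K \<O> l m \<tau> =
    {(i, j) \<in> parameters m l. \<tau> i \<in> border \<O> - pommaret_basis K \<O>}"

definition pommaret_scheme_ideal ::
    "'v::linorder monomial set \<Rightarrow> nat \<Rightarrow> (nat \<Rightarrow> 'v monomial) \<Rightarrow> nat \<Rightarrow> (nat \<Rightarrow> 'v monomial)
      \<Rightarrow> 'k::field param_poly set" where
  "pommaret_scheme_ideal \<O> l \<sigma> m \<tau> =
    (let I = pommaret_indices TYPE('k) \<O> m \<tau>
     in Idl\<^bsub>poly_ring (parameters m l - nonpommaret_parameters TYPE('k) \<O> l m \<tau>)\<^esub>
          (\<Union>(r, s) \<in> {(r, s). r \<in> I \<and> s \<in> I \<and> nonmultiplicative_couple (\<tau> r) (\<tau> s)}.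
             Poly_Mapping.range
               (reduced_form \<O> I \<tau> (\<lambda>i. pommaret_mult (\<tau> i)) (generic_marked l \<sigma> \<tau>)
                 (S_poly \<tau> (generic_marked l \<sigma> \<tau>) r s))))"

end

theory Submission
  imports Complex_Main Defs "HOL-Library.Multiset"
begin

text \<open>
  Let \<open>R\<close> be a commutative ring and \<open>b i = \<tau> i - \<dots>\<close> a marked set with coefficients in \<open>R\<close>, the tails
  being supported on \<open>\<O>\<close>. In either reduction structure, a polynomial \<open>p\<close> has a reduced form \<open>nf p\<close>
  that depends \<open>R\<close>-linearly on \<open>p\<close>, and \<open>p - nf p\<close> belongs to the ideal \<open>(b)\<close>. What may fail is the
  converse: an element of \<open>(b)\<close> can have a nonzero normal form. The ideals \<open>\<BB>\<close> and \<open>\<PP>\<close> measure this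
  failure. If \<open>I\<close> is an ideal of \<open>R\<close> containing the coefficients of the normal forms of the
  S-polynomials of neighbour couples (border structure) or of nonmultiplicative couples (Pommaret
  structure), then \<open>nf p\<close> has coefficients in \<open>I\<close> for every \<open>p\<close> in \<open>(b)\<close>. These are the lemmas
  \<open>border_criterion\<close> and \<open>pommaret_criterion\<close>. In particular, an element of \<open>(b)\<close> that is supported
  on \<open>\<O>\<close> has all its coefficients in \<open>I\<close>, because it is its own normal form.

  The border criterion rests on commuting matrices: modulo \<open>I\<close>, the S-polynomial conditions say that
  the maps \<open>h \<mapsto> nf (x\<^sub>v h)\<close> on the span of \<open>\<O>\<close> commute, so this span becomes a module over the polynomial
  ring that is generated by 1 and annihilated by the \<open>b i\<close>. The Pommaret criterion is a Buchberger argument: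
  if \<open>x\<^sub>v\<close> is not multiplicative for \<open>\<tau> i\<close>, then the S-polynomial rewrites \<open>x\<^sub>v b i\<close> as a combination of
  products \<open>\<eta> b j\<close> with \<open>\<eta>\<close> smaller than \<open>x\<^sub>v\<close> in the lexicographic order, modulo \<open>I\<close>.

  For the inclusion of \<open>\<PP>\<close> in \<open>\<BB>\<close>, let \<open>h\<close> be the Pommaret normal form of an S-polynomial of Pommaret
  marked polynomials. It lies in the ideal generated by the whole border marked set and is supported
  on \<open>\<O>\<close>, so its coefficients are in \<open>\<BB>\<close> by the border criterion. For the converse, send the
  parameter \<open>C\<^sub>i\<^sub>j\<close> to the coefficient of \<open>\<sigma> j\<close> in the Pommaret normal form of \<open>\<tau> i\<close>. This retracts the
  parameter ring onto the subring of the Pommaret parameters. It turns the generic \<open>b i\<close> into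
  \<open>\<tau> i - nf (\<tau> i)\<close>, an element of the ideal of the Pommaret marked set. The border normal form of an
  S-polynomial of neighbours therefore becomes an element of that ideal supported on \<open>\<O>\<close>, and the
  Pommaret criterion puts its coefficients in \<open>\<PP>\<close>. So the retraction maps \<open>\<BB>\<close> into \<open>\<PP>\<close>. As it fixes
  the polynomials in the Pommaret parameters, \<open>\<BB>\<close> meets their subring inside \<open>\<PP>\<close>.

  The ideals \<open>\<BB>\<close> and \<open>\<PP>\<close> live in different rings of parameters. Both criteria are applied with
  coefficients in the full polynomial type, to the preimage of \<open>\<BB>\<close> or \<open>\<PP>\<close> under a substitution
  with values in the appropriate subring; such a preimage is an ideal of the full type.
\<close>

(* Otherwise the simplifier rewrites the index set {1..m}, an argument of the constants of the
   border structure, to {Suc 0..m}. *)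
declare One_nat_def [simp del]

section \<open>Linear algebra over polynomials\<close>

text \<open>
  The first instance turns subspaces into ideals and spans into generated ideals. The second one is
  the module structure of the polynomials over their coefficients.
\<close>

interpretation ring_module: module "(*) :: 'a::comm_ring_1 \<Rightarrow> 'a \<Rightarrow> 'a"
  by unfold_locales (simp_all add: algebra_simps)

interpretation coeff_module:
  module "\<lambda>(c::'a::comm_ring_1) (p::'t::comm_monoid_add \<Rightarrow>\<^sub>0 'a). single 0 c * p"
  by unfold_locales
    (simp_all add: distrib_left distrib_right single_add mult_single flip: mult.assoc)

(* In the ring itself this rule is associativity from right to left and loops with mult.assoc. *)
declare ring_module.scale_scale [simp del]

lemma poly_mapping_eq_sum_single:
  fixes p :: "'t \<Rightarrow>\<^sub>0 'a::comm_monoid_add"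
  shows "p = (\<Sum>t\<in>keys p. single t (lookup p t))"
  by (rule poly_mapping_eqI)
    (auto simp: lookup_sum lookup_single when_def in_keys_iff sum.delta')

lemma poly_mapping_single_induct [case_names single add]:
  fixes p :: "'t \<Rightarrow>\<^sub>0 'a::comm_monoid_add"
  assumes "\<And>t a. P (single t a)" and "\<And>p q. P p \<Longrightarrow> P q \<Longrightarrow> P (p + q)"
  shows "P p"
proof -
  have "P (\<Sum>t\<in>A. single t (lookup p t))" if "finite A" for A
    using that by (induction A rule: finite_induct) (use assms(1)[of undefined 0] assms in auto)
  then show ?thesis
    by (subst poly_mapping_eq_sum_single) simp
qed

lemma lookup_single_times_shift:
  fixes p :: "('v, 'a::comm_ring_1) mpoly"
  shows "lookup (single s c * p) (s + t) = c * lookup p t"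
proof (induction p rule: poly_mapping_single_induct)
  case (single u a)
  then show ?case by (simp add: mult_single lookup_single when_def)
next
  case (add p q)
  then show ?case by (simp add: distrib_left lookup_add)
qed

lemma lookup_const_times:
  fixes p :: "('v, 'a::comm_ring_1) mpoly"
  shows "lookup (single 0 c * p) t = c * lookup p t"
  using lookup_single_times_shift[of 0 c p t] by simp

lemma single_times_single_times:
  fixes p :: "('v, 'a::comm_ring_1) mpoly"
  shows "single s a * (single t c * p) = single (s + t) (a * c) * p"
  by (simp only: mult_single flip: mult.assoc)

lemma keys_single_times:
  fixes p :: "('v, 'a::comm_ring_1) mpoly"
  shows "keys (single s c * p) \<subseteq> (\<lambda>t. s + t) ` keys p"
  using keys_mult[of "single s c" p] by (auto split: if_splits)

lemma keys_single_timesD: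
  fixes p :: "('v, 'a::comm_ring_1) mpoly"
  assumes "u \<in> keys (single s c * p)" "keys p \<subseteq> A"
  shows "\<exists>t\<in>A. u = s + t"
proof -
  have "u \<in> (\<lambda>t. s + t) ` keys p" using assms(1) keys_single_times by blast
  then show ?thesis using assms(2) by blast
qed

text \<open>
  One formula for two kinds of extension from terms to polynomials: for \<open>c = single 0\<close> it is the
  linear extension of \<open>G\<close>; for multiplicative \<open>c\<close> and \<open>G\<close> it is the ring homomorphism that they induce.
\<close>

definition extend :: "('a::comm_ring_1 \<Rightarrow> 'b::comm_ring_1) \<Rightarrow> ('t \<Rightarrow> 'b) \<Rightarrow> ('t \<Rightarrow>\<^sub>0 'a) \<Rightarrow> 'b" where
  "extend c G p = (\<Sum>t\<in>keys p. c (lookup p t) * G t)"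

lemma additive_single: "additive (single u :: 'a::comm_ring_1 \<Rightarrow> _)"
  by unfold_locales (rule single_add)

context
  fixes c :: "'a::comm_ring_1 \<Rightarrow> 'b::comm_ring_1"
  assumes c: "additive c"
begin

lemma extend_superset:
  assumes "finite A" "keys p \<subseteq> A"
  shows "extend c G p = (\<Sum>t\<in>A. c (lookup p t) * G t)"
  unfolding extend_def
  by (rule sum.mono_neutral_left) (use assms additive.zero[OF c] in \<open>auto simp: in_keys_iff\<close>)

lemma additive_extend: "additive (extend c G)"
proof
  fix p q :: "'c \<Rightarrow>\<^sub>0 'a"
  let ?A = "keys p \<union> keys q"
  have "keys (p + q) \<subseteq> ?A" by (rule Poly_Mapping.keys_add)
  then show "extend c G (p + q) = extend c G p + extend c G q"
    by (simp add: extend_superset[of ?A] lookup_add additive.add[OF c] distrib_right sum.distrib)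
qed

lemma extend_single [simp]: "extend c G (single t a) = c a * G t"
  by (simp add: extend_def additive.zero[OF c])

lemma extend_mult:
  fixes p q :: "'t::comm_monoid_add \<Rightarrow>\<^sub>0 'a"
  assumes c_mult: "\<And>a b. c (a * b) = c a * c b" and G: "\<And>s t. G (s + t) = G s * G t"
  shows "extend c G (p * q) = extend c G p * extend c G q"
proof (induction p rule: poly_mapping_single_induct)
  case (single s a)
  show ?case
  proof (induction q rule: poly_mapping_single_induct)
    case (single t b)
    show ?case by (simp only: mult_single extend_single c_mult G mult.assoc mult.left_commute)
  next
    case (add p q)
    then show ?case by (simp add: distrib_left additive.add[OF additive_extend])
  qed
next
  case (add p q)
  then show ?case by (simp add: distrib_right additive.add[OF additive_extend])
qed

end

abbreviation lin_ext :: "('v monomial \<Rightarrow> ('v, 'a::comm_ring_1) mpoly) \<Rightarrow> ('v, 'a) mpoly \<Rightarrow> ('v, 'a) mpoly" where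
  "lin_ext \<equiv> extend (single 0)"

lemmas additive_lin_ext = additive_extend[OF additive_single]
lemmas lin_ext_single = extend_single[OF additive_single]

lemma lin_ext_id:
  fixes p :: "('v, 'a::comm_ring_1) mpoly"
  assumes "\<And>t. t \<in> keys p \<Longrightarrow> f t = single t 1"
  shows "lin_ext f p = p"
proof -
  have "lin_ext f p = (\<Sum>t\<in>keys p. single t (lookup p t))"
    unfolding extend_def by (rule sum.cong) (simp_all add: assms mult_single)
  then show ?thesis by (simp flip: poly_mapping_eq_sum_single)
qed

lemma lin_ext_scale: "lin_ext f (single 0 c * p) = single 0 c * lin_ext f p"
proof (induction p rule: poly_mapping_single_induct)
  case (single t a)
  then show ?case by (simp add: mult_single lin_ext_single flip: mult.assoc)
next
  case (add p q)
  then show ?case by (simp add: distrib_left additive.add[OF additive_lin_ext])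
qed

definition coeffs_in :: "'a set \<Rightarrow> ('v, 'a::comm_ring_1) mpoly set" where
  "coeffs_in I = {p. \<forall>t. lookup p t \<in> I}"

lemma subspace_coeffs_in:
  assumes I: "ring_module.subspace I"
  shows "coeff_module.subspace (coeffs_in I)"
  unfolding coeff_module.subspace_def coeffs_in_def
  by (auto simp: lookup_add lookup_const_times ring_module.subspace_0[OF I]
      ring_module.subspace_add[OF I] ring_module.subspace_scale[OF I])

lemma coeff_subspace_memI:
  assumes D: "coeff_module.subspace D" and "\<And>t. t \<in> keys p \<Longrightarrow> single t 1 \<in> D"
  shows "p \<in> D"
proof -
  have "single t (lookup p t) \<in> D" if "t \<in> keys p" for t
    using coeff_module.subspace_scale[OF D assms(2)[OF that], of "lookup p t"]
    by (simp add: mult_single)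
  then have "(\<Sum>t\<in>keys p. single t (lookup p t)) \<in> D"
    by (intro coeff_module.subspace_sum[OF D])
  then show ?thesis
    by (simp flip: poly_mapping_eq_sum_single)
qed

lemma lin_ext_mem:
  assumes D: "coeff_module.subspace D" and "\<And>t. t \<in> keys p \<Longrightarrow> f t \<in> D"
  shows "lin_ext f p \<in> D"
  unfolding extend_def using assms(2)
  by (intro coeff_module.subspace_sum[OF D] coeff_module.subspace_scale[OF D])

lemma lin_ext_coeffs_in:
  assumes I: "ring_module.subspace I" and p: "p \<in> coeffs_in I"
  shows "lin_ext f p \<in> coeffs_in I"
proof -
  have "single 0 (lookup p t) * f t \<in> coeffs_in I" for t
    using p unfolding coeffs_in_def
    by (simp add: lookup_const_times) (metis I mult.commute ring_module.subspace_scale)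
  then show ?thesis
    unfolding extend_def by (intro coeff_module.subspace_sum[OF subspace_coeffs_in[OF I]])
qed

lemma times_coeffs_in:
  assumes I: "ring_module.subspace I" and p: "p \<in> coeffs_in I"
  shows "q * p \<in> coeffs_in I"
proof (induction q rule: poly_mapping_single_induct)
  case (single s a)
  have "single s a * single t (lookup p t) \<in> coeffs_in I" for t
    using p I unfolding mult_single
    by (auto simp: coeffs_in_def lookup_single when_def
        intro!: ring_module.subspace_scale ring_module.subspace_0)
  then have "single s a * (\<Sum>t\<in>keys p. single t (lookup p t)) \<in> coeffs_in I"
    unfolding sum_distrib_left by (intro coeff_module.subspace_sum[OF subspace_coeffs_in[OF I]])
  then show ?case by (simp flip: poly_mapping_eq_sum_single)
next
  case (add q q')
  then show ?case
    by (simp add: distrib_right coeff_module.subspace_add[OF subspace_coeffs_in[OF I]])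
qed

lemma subspace_vimage_lin_ext:
  assumes D: "coeff_module.subspace D"
  shows "coeff_module.subspace {p. lin_ext f (q * p) \<in> D}"
proof -
  have "lin_ext f (q * (single 0 c * p)) = single 0 c * lin_ext f (q * p)" for c p
    by (simp only: mult.left_commute[of q] lin_ext_scale)
  then show ?thesis
    unfolding coeff_module.subspace_def
    by (auto simp: distrib_left additive.add[OF additive_lin_ext] additive.zero[OF additive_lin_ext]
        coeff_module.subspace_0[OF D] coeff_module.subspace_add[OF D] coeff_module.subspace_scale[OF D])
qed

text \<open>
  A linear map sends an ideal into a submodule as soon as it sends all products of a term and a
  generator there.
\<close>

lemma lin_ext_span_mem:
  assumes D: "coeff_module.subspace D"
    and gen: "\<And>t x. x \<in> B \<Longrightarrow> lin_ext f (single t 1 * x) \<in> D"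
    and p: "p \<in> ring_module.span B"
  shows "lin_ext f p \<in> D"
proof -
  have "\<forall>q. lin_ext f (q * p) \<in> D"
    using p
  proof (induction rule: ring_module.span_induct)
    case base
    show ?case
      unfolding ring_module.subspace_def
      by (auto simp: distrib_left additive.add[OF additive_lin_ext] additive.zero[OF additive_lin_ext]
      coeff_module.subspace_0[OF D] coeff_module.subspace_add[OF D] simp flip: mult.assoc)
  next
    case (step x)
    have "q \<in> {q. lin_ext f (x * q) \<in> D}" for q
      by (rule coeff_subspace_memI[OF subspace_vimage_lin_ext[OF D]])
        (use gen[OF step] in \<open>simp add: mult.commute\<close>)
    then show ?case by (simp add: mult.commute)
  qed
  from this[rule_format, of 1] show ?thesis by simp
qed

lemma coeff_subspace_span: "coeff_module.subspace (ring_module.span B)"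
  unfolding coeff_module.subspace_def
  by (auto intro: ring_module.span_zero ring_module.span_add ring_module.span_scale)

section \<open>Polynomial subrings and substitution\<close>

lemma poly_ring_simps [simp]:
  "monoid.mult (poly_ring V) = (*)" "monoid.one (poly_ring V) = 1" "ring.zero (poly_ring V) = 0" "ring.add (poly_ring V) = (+)"
  by (simp_all add: poly_ring_def)

lemma carrier_poly_ring: "p \<in> carrier (poly_ring V) \<longleftrightarrow> (\<forall>t\<in>keys p. keys t \<subseteq> V)"
  by (simp add: poly_ring_def)

lemma ring_poly_ring: "ring (poly_ring V :: ('v, 'a::comm_ring_1) mpoly ring)"
  using cring_poly_ring by (rule cring.axioms)

lemma poly_ring_closed:
  fixes p q :: "('v, 'a::comm_ring_1) mpoly"
  shows "0 \<in> carrier (poly_ring V :: ('v, 'a) mpoly ring)" "1 \<in> carrier (poly_ring V :: ('v, 'a) mpoly ring)"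
    "p \<in> carrier (poly_ring V) \<Longrightarrow> q \<in> carrier (poly_ring V) \<Longrightarrow> p + q \<in> carrier (poly_ring V)"
    "p \<in> carrier (poly_ring V) \<Longrightarrow> q \<in> carrier (poly_ring V) \<Longrightarrow> p * q \<in> carrier (poly_ring V)"
  using ring.ring_simprules(1,2,5,6)[OF ring_poly_ring[of V]] by simp_all

lemma poly_ring_uminus:
  fixes p :: "('v, 'a::comm_ring_1) mpoly"
  shows "p \<in> carrier (poly_ring V) \<Longrightarrow> - p \<in> carrier (poly_ring V)"
  by (simp add: carrier_poly_ring)

lemma poly_ring_diff:
  fixes p q :: "('v, 'a::comm_ring_1) mpoly"
  shows "p \<in> carrier (poly_ring V) \<Longrightarrow> q \<in> carrier (poly_ring V) \<Longrightarrow> p - q \<in> carrier (poly_ring V)"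
  using poly_ring_closed(3)[OF _ poly_ring_uminus, of p V q] by simp

lemma poly_ring_sum:
  fixes f :: "'i \<Rightarrow> ('v, 'a::comm_ring_1) mpoly"
  shows "(\<And>i. i \<in> A \<Longrightarrow> f i \<in> carrier (poly_ring V)) \<Longrightarrow> sum f A \<in> carrier (poly_ring V)"
  by (induction A rule: infinite_finite_induct) (simp_all add: poly_ring_closed)

lemma poly_ring_power:
  fixes p :: "('v, 'a::comm_ring_1) mpoly"
  shows "p \<in> carrier (poly_ring V) \<Longrightarrow> p ^ n \<in> carrier (poly_ring V)"
  by (induction n) (simp_all add: poly_ring_closed)

lemma poly_ring_prod:
  fixes f :: "'i \<Rightarrow> ('v, 'a::comm_ring_1) mpoly"
  shows "(\<And>i. i \<in> A \<Longrightarrow> f i \<in> carrier (poly_ring V)) \<Longrightarrow> prod f A \<in> carrier (poly_ring V)"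
  by (induction A rule: infinite_finite_induct) (simp_all add: poly_ring_closed)

lemma poly_ring_mono: "V \<subseteq> W \<Longrightarrow> carrier (poly_ring V) \<subseteq> carrier (poly_ring W)"
  unfolding poly_ring_def by (simp add: Collect_mono_iff) (meson order_trans)

lemma poly_ring_idealI:
  fixes A :: "('v, 'a::comm_ring_1) mpoly set"
  assumes "A \<subseteq> carrier (poly_ring V)" "0 \<in> A" "\<And>p q. p \<in> A \<Longrightarrow> q \<in> A \<Longrightarrow> p + q \<in> A"
    and mult: "\<And>r p. r \<in> carrier (poly_ring V) \<Longrightarrow> p \<in> A \<Longrightarrow> r * p \<in> A"
  shows "ideal A (poly_ring V)"
proof (rule idealI[OF ring_poly_ring])
  interpret ring "poly_ring V :: ('v, 'a) mpoly ring" by (rule ring_poly_ring)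
  have neg: "\<ominus>\<^bsub>poly_ring V\<^esub> p \<in> A" if "p \<in> A" for p
  proof -
    have "- p \<in> A"
      using mult[OF poly_ring_uminus[OF poly_ring_closed(2)] that] by simp
    moreover have "\<ominus>\<^bsub>poly_ring V\<^esub> p = - p"
      by (rule minus_equality) (use assms(1) \<open>p \<in> A\<close> \<open>- p \<in> A\<close> in auto)
    ultimately show ?thesis by simp
  qed
  show "subgroup A (add_monoid (poly_ring V))"
    by (rule subgroup.intro) (use assms(1-3) neg in \<open>auto simp: a_inv_def\<close>)
  show "x \<otimes>\<^bsub>poly_ring V\<^esub> p \<in> A" if "p \<in> A" "x \<in> carrier (poly_ring V)" for p x
    using mult[OF that(2,1)] by simp
  then show "p \<otimes>\<^bsub>poly_ring V\<^esub> x \<in> A" if "p \<in> A" "x \<in> carrier (poly_ring V)" for p x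
    using that by (simp add: mult.commute[of p])
qed

lemma poly_ring_idealD:
  fixes A :: "('v, 'a::comm_ring_1) mpoly set"
  assumes "ideal A (poly_ring V)"
  shows "A \<subseteq> carrier (poly_ring V)" "0 \<in> A" "p \<in> A \<Longrightarrow> q \<in> A \<Longrightarrow> p + q \<in> A"
    "r \<in> carrier (poly_ring V) \<Longrightarrow> p \<in> A \<Longrightarrow> r * p \<in> A"
proof -
  note add = ideal.axioms(1)[OF assms]
  show "A \<subseteq> carrier (poly_ring V)" by (rule additive_subgroup.a_subset[OF add])
  show "0 \<in> A" using additive_subgroup.zero_closed[OF add] by simp
  show "p \<in> A \<Longrightarrow> q \<in> A \<Longrightarrow> p + q \<in> A"
    using additive_subgroup.a_closed[OF add, of p q] by simp
  show "r \<in> carrier (poly_ring V) \<Longrightarrow> p \<in> A \<Longrightarrow> r * p \<in> A"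
    using ideal.I_l_closed[OF assms, of p r] by simp
qed

definition eval_term :: "('w \<Rightarrow> 'r::comm_ring_1) \<Rightarrow> 'w monomial \<Rightarrow> 'r" where
  "eval_term g t = (\<Prod>w\<in>keys t. g w ^ lookup t w)"

lemma eval_term_add: "eval_term g (s + t) = eval_term g s * eval_term g t"
proof -
  have superset: "eval_term g u = (\<Prod>w\<in>keys s \<union> keys t. g w ^ lookup u w)"
    if "keys u \<subseteq> keys s \<union> keys t" for u
    unfolding eval_term_def using that
    by (intro prod.mono_neutral_left) (auto simp: in_keys_iff)
  show ?thesis
    using Poly_Mapping.keys_add[of s t]
    by (simp add: superset lookup_add power_add prod.distrib)
qed

lemma eval_term_zero [simp]: "eval_term g 0 = 1"
  by (simp add: eval_term_def)

lemma eval_term_tvar [simp]: "eval_term g (tvar w) = g w"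
  by (simp add: eval_term_def tvar_def)

abbreviation pvar :: "'w \<Rightarrow> ('w, 'a::comm_ring_1) mpoly" where
  "pvar w \<equiv> single (tvar w) 1"

lemma eval_term_self:
  fixes g :: "'w \<Rightarrow> ('w, 'r::comm_ring_1) mpoly"
  assumes "\<And>w. w \<in> keys t \<Longrightarrow> g w = pvar w"
  shows "eval_term g t = single t 1"
proof -
  have power: "pvar w ^ n = (single (single w n) 1 :: ('w, 'r) mpoly)" for w :: 'w and n
  proof (induction n)
    case (Suc n)
    have "single w 1 + single w n = single w (Suc n)"
      by (simp only: Suc_eq_plus1_left flip: single_add)
    then show ?case using Suc by (simp add: mult_single tvar_def)
  qed simp
  have "(\<Prod>w\<in>A. pvar w ^ lookup t w)
      = (single (\<Sum>w\<in>A. single w (lookup t w)) 1 :: ('w, 'r) mpoly)" for A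
    by (induction A rule: infinite_finite_induct) (simp_all add: power mult_single)
  then show ?thesis
    using assms unfolding eval_term_def by (simp flip: poly_mapping_eq_sum_single)
qed

definition substitute :: "('w \<Rightarrow> ('w, 'k::comm_ring_1) mpoly) \<Rightarrow> ('w, 'k) mpoly \<Rightarrow> ('w, 'k) mpoly" where
  "substitute g = extend (single 0) (eval_term g)"

lemma additive_substitute: "additive (substitute g)"
  unfolding substitute_def by (rule additive_extend[OF additive_single])

lemma substitute_mult: "substitute g (p * q) = substitute g p * substitute g q"
  unfolding substitute_def
  by (rule extend_mult[OF additive_single]) (simp_all add: mult_single eval_term_add)

lemma substitute_one [simp]: "substitute g 1 = 1"
  using extend_single[OF additive_single, where G = "eval_term g" and t = 0 and a = 1] by (simp add: substitute_def)

lemma substitute_pvar [simp]: "substitute g (pvar w) = g w"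
  using extend_single[OF additive_single, where G = "eval_term g" and t = "tvar w" and a = 1] by (simp add: substitute_def)

lemma substitute_in_poly_ring:
  assumes "\<And>w. g w \<in> carrier (poly_ring V)"
  shows "substitute g p \<in> carrier (poly_ring V)"
proof -
  have "single 0 c \<in> carrier (poly_ring V)" for c by (simp add: carrier_poly_ring)
  then show ?thesis
    unfolding substitute_def extend_def eval_term_def
    by (intro poly_ring_sum poly_ring_closed(4) poly_ring_prod poly_ring_power assms)
qed

lemma substitute_self:
  assumes "\<And>w. w \<in> V \<Longrightarrow> g w = pvar w" and "p \<in> carrier (poly_ring V)"
  shows "substitute g p = p"
proof -
  have "eval_term g t = single t 1" if "t \<in> keys p" for t
    using that assms by (intro eval_term_self) (auto simp: carrier_poly_ring)
  then have "substitute g p = (\<Sum>t\<in>keys p. single t (lookup p t))"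
    unfolding substitute_def extend_def by (intro sum.cong) (simp_all add: mult_single)
  then show ?thesis by (simp flip: poly_mapping_eq_sum_single)
qed

text \<open>
  Ideals of a subring are replaced by ideals of the full polynomial type, so that coefficients in
  congruences need not be confined to the subring.
\<close>

lemma subspace_substitute_preimage:
  assumes I: "ideal I (poly_ring V)" and g: "\<And>w. g w \<in> carrier (poly_ring V)"
  shows "ring_module.subspace {p. substitute g p \<in> I}"
  using poly_ring_idealD[OF I] substitute_in_poly_ring[OF g]
  by (auto intro!: ring_module.subspaceI
      simp: additive.zero[OF additive_substitute] additive.add[OF additive_substitute] substitute_mult)

definition map_coeffs :: "('a::comm_ring_1 \<Rightarrow> 'a) \<Rightarrow> ('v, 'a) mpoly \<Rightarrow> ('v, 'a) mpoly" where
  "map_coeffs \<phi> = extend (\<lambda>a. single 0 (\<phi> a)) (\<lambda>t. single t 1)"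

context
  fixes \<phi> :: "'a::comm_ring_1 \<Rightarrow> 'a"
  assumes \<phi>: "additive \<phi>"
begin

lemma additive_single_hom: "additive (\<lambda>a. single t (\<phi> a))"
  by unfold_locales (simp add: additive.add[OF \<phi>] single_add)

lemma additive_map_coeffs: "additive (map_coeffs \<phi>)"
  unfolding map_coeffs_def by (rule additive_extend[OF additive_single_hom])

lemma map_coeffs_single: "map_coeffs \<phi> (single t a) = single t (\<phi> a)"
  unfolding map_coeffs_def by (simp add: extend_single[OF additive_single_hom] mult_single)

lemma lookup_map_coeffs: "lookup (map_coeffs \<phi> p) t = \<phi> (lookup p t)"
proof (induction p rule: poly_mapping_single_induct)
  case (single s a)
  then show ?case by (simp add: map_coeffs_single lookup_single when_def additive.zero[OF \<phi>])
next
  case (add p q)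
  then show ?case
    by (simp add: additive.add[OF additive_map_coeffs] lookup_add additive.add[OF \<phi>])
qed

lemma map_coeffs_mult:
  assumes "\<And>a b. \<phi> (a * b) = \<phi> a * \<phi> b"
  shows "map_coeffs \<phi> (p * q) = map_coeffs \<phi> p * map_coeffs \<phi> q"
  unfolding map_coeffs_def
  by (rule extend_mult[OF additive_single_hom]) (simp_all add: assms mult_single)

lemma keys_map_coeffs: "keys (map_coeffs \<phi> p) \<subseteq> keys p"
  by (auto simp: in_keys_iff lookup_map_coeffs additive.zero[OF \<phi>])

end

lemma range_subset_iff:
  assumes "0 \<in> A"
  shows "Poly_Mapping.range p \<subseteq> A \<longleftrightarrow> p \<in> coeffs_in A"
proof
  assume "Poly_Mapping.range p \<subseteq> A"
  then have "lookup p t \<in> A" for t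
    using assms in_keys_lookup_in_range[of t p] by (cases "t \<in> keys p") (auto simp: in_keys_iff)
  then show "p \<in> coeffs_in A" by (simp add: coeffs_in_def)
next
  assume "p \<in> coeffs_in A"
  then show "Poly_Mapping.range p \<subseteq> A"
    by (simp add: coeffs_in_def range.rep_eq) blast
qed

lemma coeffs_in_single_times:
  assumes "p \<in> coeffs_in A" "0 \<in> A"
  shows "single s 1 * p \<in> coeffs_in A"
proof -
  have "lookup (single s 1 * p) u \<in> A" for u
  proof (cases "u \<in> keys (single s 1 * p)")
    case True
    then obtain t where "u = s + t" using keys_single_timesD by blast
    then show ?thesis using assms(1) by (simp add: lookup_single_times_shift coeffs_in_def)
  qed (simp add: assms(2) in_keys_iff)
  then show ?thesis by (simp add: coeffs_in_def)
qed

lemma coeffs_in_diff: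
  assumes "p \<in> coeffs_in (carrier (poly_ring V))" "q \<in> coeffs_in (carrier (poly_ring V))"
  shows "p - q \<in> coeffs_in (carrier (poly_ring V))"
  using assms by (simp add: coeffs_in_def lookup_minus poly_ring_diff)

section \<open>Reduction structures\<close>

text \<open>
  The common features of the border and of the Pommaret structure. The cones partition the terms
  outside \<open>\<O>\<close>; when a head term is replaced by a term of the tail, the multiplier that places the
  result in its cone goes down in the well-founded relation \<open>r\<close>.
\<close>

locale marked_structure =
  fixes \<O> :: "'v monomial set"
    and IX :: "nat set"
    and ht :: "nat \<Rightarrow> 'v monomial"
    and T :: "nat \<Rightarrow> 'v monomial set"
    and b :: "nat \<Rightarrow> ('v, 'a::comm_ring_1) mpoly"
    and r :: "('v monomial \<times> 'v monomial) set"
  assumes cone_cover: "t \<notin> \<O> \<Longrightarrow> \<exists>i\<in>IX. \<exists>\<eta>\<in>T i. t = \<eta> + ht i"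
    and cone_notin: "i \<in> IX \<Longrightarrow> \<eta> \<in> T i \<Longrightarrow> \<eta> + ht i \<notin> \<O>"
    and cone_disjoint: "i \<in> IX \<Longrightarrow> j \<in> IX \<Longrightarrow> \<eta> \<in> T i \<Longrightarrow> \<eta>' \<in> T j \<Longrightarrow>
      \<eta> + ht i = \<eta>' + ht j \<Longrightarrow> i = j"
    and keys_tail: "i \<in> IX \<Longrightarrow> keys (single (ht i) 1 - b i) \<subseteq> \<O>"
    and wf_r: "wf r"
    and cofactor_decreases: "i \<in> IX \<Longrightarrow> j \<in> IX \<Longrightarrow> \<eta> \<in> T i \<Longrightarrow> \<eta>' \<in> T j \<Longrightarrow> s \<in> \<O> \<Longrightarrow>
      \<eta> + s = \<eta>' + ht j \<Longrightarrow> (\<eta>', \<eta>) \<in> r"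
begin

definition tail :: "nat \<Rightarrow> ('v, 'a) mpoly" where
  "tail i = single (ht i) 1 - b i"

definition cone_index :: "'v monomial \<Rightarrow> nat" where
  "cone_index t = (THE i. i \<in> IX \<and> (\<exists>\<eta>\<in>T i. t = \<eta> + ht i))"

text \<open>
  The multiplier of a term in its cone.
\<close>

definition cofactor :: "'v monomial \<Rightarrow> 'v monomial" where
  "cofactor t = t - ht (cone_index t)"

lemma cone_index_eq: "i \<in> IX \<Longrightarrow> \<eta> \<in> T i \<Longrightarrow> cone_index (\<eta> + ht i) = i"
  unfolding cone_index_def by (rule the_equality) (use cone_disjoint in metis)+

lemma cofactor_eq: "i \<in> IX \<Longrightarrow> \<eta> \<in> T i \<Longrightarrow> cofactor (\<eta> + ht i) = \<eta>"
  by (simp add: cofactor_def cone_index_eq)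

lemma cone_decomp:
  assumes "t \<notin> \<O>"
  shows "cone_index t \<in> IX" and "cofactor t \<in> T (cone_index t)"
    and "cofactor t + ht (cone_index t) = t"
proof -
  obtain i \<eta> where *: "i \<in> IX" "\<eta> \<in> T i" "t = \<eta> + ht i"
    using cone_cover[OF assms] by blast
  show "cone_index t \<in> IX" "cofactor t \<in> T (cone_index t)" "cofactor t + ht (cone_index t) = t"
    using * by (simp_all add: cone_index_eq cofactor_eq)
qed

lemma cofactor_tail_decreases:
  assumes "t \<notin> \<O>" "s \<in> \<O>" "cofactor t + s \<notin> \<O>"
  shows "(cofactor (cofactor t + s), cofactor t) \<in> r"
  using cofactor_decreases[OF cone_decomp(1)[OF assms(1)] cone_decomp(1)[OF assms(3)]
      cone_decomp(2)[OF assms(1)] cone_decomp(2)[OF assms(3)] assms(2)]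
    cone_decomp(3)[OF assms(3)] by simp

text \<open>
  Terms of \<open>\<O>\<close> lie below all others, which are compared by their multipliers. Every reduction
  replaces a term by smaller ones.
\<close>

definition term_rel :: "('v monomial \<times> 'v monomial) set" where
  "term_rel = inv_image (less_than <*lex*> r) (\<lambda>t. (if t \<in> \<O> then 0 else 1, cofactor t))"

lemma wf_term_rel: "wf term_rel"
  unfolding term_rel_def by (intro wf_inv_image wf_lex_prod wf_less_than wf_r)

lemma term_rel_tail:
  assumes "t \<notin> \<O>" "s \<in> \<O>"
  shows "(cofactor t + s, t) \<in> term_rel"
  using cofactor_tail_decreases[OF assms] assms(1) by (auto simp: term_rel_def)

lemma keys_tail': "i \<in> IX \<Longrightarrow> keys (tail i) \<subseteq> \<O>"
  unfolding tail_def by (rule keys_tail)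

text \<open>
  The value that a complete reduction of the term must have. Defining it by recursion makes the
  reduced form linear by construction.
\<close>

function nf_term :: "'v monomial \<Rightarrow> ('v, 'a) mpoly" where
  "nf_term t = (if t \<in> \<O> then single t 1 else
     (\<Sum>s\<in>keys (tail (cone_index t)).
        single 0 (lookup (tail (cone_index t)) s) * nf_term (cofactor t + s)))"
  by auto
termination
  using wf_term_rel
proof (rule local.termination)
  fix t s assume "t \<notin> \<O>" "s \<in> keys (tail (cone_index t))"
  then show "(cofactor t + s, t) \<in> term_rel"
    using term_rel_tail keys_tail' cone_decomp(1) by blast
qed

declare nf_term.simps [simp del]

definition nf :: "('v, 'a) mpoly \<Rightarrow> ('v, 'a) mpoly" where
  "nf = lin_ext nf_term"

lemma nf_term_in: "t \<in> \<O> \<Longrightarrow> nf_term t = single t 1"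
  by (simp add: nf_term.simps)

lemma additive_nf: "additive nf"
  unfolding nf_def by (rule additive_lin_ext)

lemmas nf_add = additive.add[OF additive_nf]
lemmas nf_diff = additive.diff[OF additive_nf]
lemma nf_scale: "nf (single 0 c * p) = single 0 c * nf p"
  unfolding nf_def by (rule lin_ext_scale)

lemma nf_monomial: "nf (single t 1) = nf_term t"
  unfolding nf_def by (simp add: lin_ext_single)

lemma nf_reduced: "keys p \<subseteq> \<O> \<Longrightarrow> nf p = p"
  unfolding nf_def by (rule lin_ext_id) (use nf_term_in in blast)

lemma nf_marked:
  assumes "i \<in> IX" "\<eta> \<in> T i"
  shows "nf (single \<eta> 1 * b i) = 0"
proof -
  let ?t = "\<eta> + ht i"
  have shift: "nf (single \<eta> 1 * p) = (\<Sum>s\<in>keys p. single 0 (lookup p s) * nf_term (\<eta> + s))" for p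
  proof -
    have "single \<eta> 1 * p = (\<Sum>s\<in>keys p. single 0 (lookup p s) * single (\<eta> + s) 1)"
      by (subst poly_mapping_eq_sum_single) (simp add: sum_distrib_left mult_single)
    then show ?thesis
      by (simp add: additive.sum[OF additive_nf] nf_scale nf_monomial)
  qed
  have "b i = single (ht i) 1 - tail i"
    by (simp add: tail_def)
  then have "nf (single \<eta> 1 * b i) = nf (single ?t 1) - nf (single \<eta> 1 * tail i)"
    by (simp add: right_diff_distrib mult_single nf_diff)
  also have "nf (single \<eta> 1 * tail i) = nf_term ?t"
    using assms cone_notin[OF assms]
    by (subst nf_term.simps) (simp add: shift cone_index_eq cofactor_eq)
  finally show ?thesis by (simp add: nf_monomial)
qed

text \<open>
  The head term is in its own cone with multiplier 1, so one step reduces it completely.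
\<close>

lemma nf_term_head:
  assumes i: "i \<in> IX" and "0 \<in> T i"
  shows "nf_term (ht i) = tail i"
proof -
  have "nf (single 0 1 * b i) = 0"
    by (rule nf_marked[OF assms])
  then have "nf (single (ht i) 1 - tail i) = 0"
    by (simp add: tail_def)
  then show ?thesis
    using nf_reduced[OF keys_tail'[OF i]] by (simp add: nf_diff nf_monomial)
qed

lemma keys_nf: "keys (nf p) \<subseteq> \<O>"
proof -
  let ?D = "{p :: ('v, 'a) mpoly. keys p \<subseteq> \<O>}"
  have D: "coeff_module.subspace ?D"
  proof (rule coeff_module.subspaceI)
    show "p + q \<in> ?D" if "p \<in> ?D" "q \<in> ?D" for p q
      using that Poly_Mapping.keys_add[of p q] by blast
    show "single 0 c * p \<in> ?D" if "p \<in> ?D" for c p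
      using that keys_single_times[of 0 c p] by auto
  qed simp
  have "nf_term t \<in> ?D" for t
  proof (induction t rule: wf_induct_rule[OF wf_term_rel])
    case (1 t)
    show ?case
    proof (cases "t \<in> \<O>")
      case True
      then show ?thesis by (simp add: nf_term_in)
    next
      case False
      have "(\<Sum>s\<in>keys (tail (cone_index t)).
        single 0 (lookup (tail (cone_index t)) s) * nf_term (cofactor t + s)) \<in> ?D"
        using 1 keys_tail'[OF cone_decomp(1)[OF False]] term_rel_tail[OF False]
        by (intro coeff_module.subspace_sum[OF D] coeff_module.subspace_scale[OF D]) blast
      then show ?thesis using False by (subst nf_term.simps) simp
    qed
  qed
  then have "nf p \<in> ?D"
    unfolding nf_def by (rule lin_ext_mem[OF D])
  then show ?thesis by simp
qed

text \<open>
  The reduction of \<open>p\<close> subtracts only multiples \<open>\<eta> b i\<close> with multiplicative \<open>\<eta>\<close>, and each \<open>\<eta>\<close> is at most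
  the multiplier of some term of \<open>p\<close>. The predicate \<open>Q\<close> is an initial segment that bounds the
  multipliers.
\<close>

lemma diff_nf_mem:
  assumes D: "coeff_module.subspace D"
    and down: "\<And>\<eta> \<eta>'. Q \<eta> \<Longrightarrow> (\<eta>', \<eta>) \<in> r \<Longrightarrow> Q \<eta>'"
    and gen: "\<And>i \<eta>. i \<in> IX \<Longrightarrow> \<eta> \<in> T i \<Longrightarrow> Q \<eta> \<Longrightarrow> single \<eta> 1 * b i \<in> D"
    and p: "\<And>t. t \<in> keys p \<Longrightarrow> t \<notin> \<O> \<Longrightarrow> Q (cofactor t)"
  shows "p - nf p \<in> D"
proof -
  have *: "single t 1 - nf_term t \<in> D" if "t \<notin> \<O> \<longrightarrow> Q (cofactor t)" for t
    using that
  proof (induction t rule: wf_induct_rule[OF wf_term_rel])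
    case (1 t)
    show ?case
    proof (cases "t \<in> \<O>")
      case True
      then show ?thesis by (simp add: nf_term_in coeff_module.subspace_0[OF D])
    next
      case False
      let ?i = "cone_index t" and ?\<eta> = "cofactor t"
      let ?c = "\<lambda>s. single 0 (lookup (tail ?i) s)"
      have step: "single (?\<eta> + s) 1 - nf_term (?\<eta> + s) \<in> D" if "s \<in> keys (tail ?i)" for s
      proof (rule 1(1))
        have s: "s \<in> \<O>" using that keys_tail'[OF cone_decomp(1)[OF False]] by blast
        show "(?\<eta> + s, t) \<in> term_rel" by (rule term_rel_tail[OF False s])
        show "?\<eta> + s \<notin> \<O> \<longrightarrow> Q (cofactor (?\<eta> + s))"
          using down cofactor_tail_decreases[OF False s] 1(2) False by blast
      qed
      have "single t 1 = single ?\<eta> 1 * b ?i + single ?\<eta> 1 * tail ?i"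
        using cone_decomp(3)[OF False] by (simp add: tail_def mult_single right_diff_distrib)
      also have "single ?\<eta> 1 * tail ?i = (\<Sum>s\<in>keys (tail ?i). ?c s * single (?\<eta> + s) 1)"
        by (subst poly_mapping_eq_sum_single[of "tail ?i"]) (simp add: sum_distrib_left mult_single)
      finally have "single t 1 - nf_term t = single ?\<eta> 1 * b ?i
          + (\<Sum>s\<in>keys (tail ?i). ?c s * (single (?\<eta> + s) 1 - nf_term (?\<eta> + s)))"
        using False by (subst nf_term.simps) (simp add: right_diff_distrib sum_subtractf)
      also have "\<dots> \<in> D"
        using gen[OF cone_decomp(1,2)[OF False]] 1(2) False step
        by (intro coeff_module.subspace_add[OF D] coeff_module.subspace_sum[OF D]
            coeff_module.subspace_scale[OF D]) auto
      finally show ?thesis .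
    qed
  qed
  have "p - nf p = lin_ext (\<lambda>t. single t 1 - nf_term t) p"
    unfolding nf_def extend_def right_diff_distrib sum_subtractf
    by (simp add: mult_single flip: poly_mapping_eq_sum_single)
  also have "\<dots> \<in> D"
    by (rule lin_ext_mem[OF D]) (use * p in blast)
  finally show ?thesis .
qed

lemma diff_nf_in_span: "p - nf p \<in> ring_module.span (b ` IX)"
  by (rule diff_nf_mem[where Q = "\<lambda>_. True"])
    (auto intro: coeff_subspace_span ring_module.span_scale ring_module.span_base)

lemma reduction_step_nf:
  assumes "reduction_step IX ht T b g g'"
  shows "nf g' = nf g"
proof -
  obtain i \<eta> where *: "i \<in> IX" "\<eta> \<in> T i"
    and g': "g' = g - single \<eta> (lookup g (\<eta> + ht i)) * b i"
    using assms by (auto simp: reduction_step_def)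
  have "g' = g - single 0 (lookup g (\<eta> + ht i)) * (single \<eta> 1 * b i)"
    by (simp add: g' mult_single flip: mult.assoc)
  then show ?thesis by (simp only: nf_diff nf_scale nf_marked[OF *] mult_zero_right diff_zero)
qed

text \<open>
  The multiset of the terms of \<open>g\<close> goes down when a term is exchanged for smaller ones. Comparing
  multisets takes care of terms of \<open>g\<close> that cancel against the newly created ones.
\<close>

lemma reduction_step_less:
  assumes t: "t \<in> keys g" "t \<notin> \<O>"
  shows "\<exists>g'. reduction_step IX ht T b g g' \<and>
    (mset_set (keys g'), mset_set (keys g)) \<in> mult term_rel"
proof (intro exI conjI)
  let ?i = "cone_index t" and ?\<eta> = "cofactor t"
  let ?g' = "g - single ?\<eta> (lookup g (?\<eta> + ht ?i)) * b ?i"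
  have t_eq: "?\<eta> + ht ?i = t" using cone_decomp(3)[OF t(2)] by simp
  show "reduction_step IX ht T b g ?g'"
    unfolding reduction_step_def using cone_decomp(1,2)[OF t(2)] t(1) t_eq by metis
  have g': "?g' = (g - single t (lookup g t)) + single ?\<eta> (lookup g t) * tail ?i"
    by (simp add: tail_def t_eq right_diff_distrib mult_single)
  have "?\<eta> + s \<noteq> t" if "s \<in> \<O>" for s
    using wf_not_refl[OF wf_term_rel] term_rel_tail[OF t(2) that] by metis
  then have "t \<notin> keys (single ?\<eta> (lookup g t) * tail ?i)"
    using keys_single_times keys_tail'[OF cone_decomp(1)[OF t(2)]] by fastforce
  then have t_notin: "t \<notin> keys ?g'"
    by (simp add: g' in_keys_iff lookup_add lookup_minus)
  have lower: "(u, t) \<in> term_rel" if "u \<in> keys ?g' - keys g" for u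
  proof -
    from that t(1) have "lookup (single t (lookup g t)) u = 0" "lookup g u = 0"
      by (auto simp: lookup_single when_def in_keys_iff)
    with that have "u \<in> keys (single ?\<eta> (lookup g t) * tail ?i)"
      by (simp add: g' in_keys_iff lookup_add lookup_minus)
    then obtain s where "u = ?\<eta> + s" "s \<in> keys (tail ?i)"
      using keys_single_times by blast
    then show ?thesis
      using term_rel_tail[OF t(2)] keys_tail'[OF cone_decomp(1)[OF t(2)]] by blast
  qed
  let ?M = "\<lambda>A. mset_set A"
  have "(?M (keys ?g' \<inter> keys g) + ?M (keys ?g' - keys g),
         ?M (keys ?g' \<inter> keys g) + ?M (keys g - keys ?g')) \<in> mult term_rel"
    using lower t(1) t_notin by (intro one_step_implies_mult) (auto simp: mset_set_empty_iff)
  moreover have "?M (keys p \<inter> keys q) + ?M (keys p - keys q) = ?M (keys p)" for p q :: "('v, 'a) mpoly"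
    by (subst mset_set_Union[symmetric]) (auto simp: Int_Diff_Un)
  ultimately show "(?M (keys ?g'), ?M (keys g)) \<in> mult term_rel"
    by (metis Int_commute)
qed

lemma reduces_to_nf: "(reduction_step IX ht T b)\<^sup>*\<^sup>* g (nf g)"
proof (induction g rule: wf_induct_rule[OF wf_inv_image[OF wf_mult[OF wf_term_rel],
        of "\<lambda>g. mset_set (keys g)"]])
  case (1 g)
  show ?case
  proof (cases "keys g \<subseteq> \<O>")
    case True
    then show ?thesis by (simp add: nf_reduced)
  next
    case False
    then obtain g' where "reduction_step IX ht T b g g'"
      and "(mset_set (keys g'), mset_set (keys g)) \<in> mult term_rel"
      using reduction_step_less by blast
    then show ?thesis
      using 1 reduction_step_nf by (metis converse_rtranclp_into_rtranclp in_inv_image)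
  qed
qed

text \<open>
  Each step preserves \<open>nf\<close>, and \<open>nf\<close> is the identity on polynomials supported on \<open>\<O>\<close>, whence
  uniqueness of the reduced form.
\<close>

lemma reduced_form_eq_nf: "reduced_form \<O> IX ht T b g = nf g"
  unfolding reduced_form_def
proof (rule the_equality)
  show "(reduction_step IX ht T b)\<^sup>*\<^sup>* g (nf g) \<and> keys (nf g) \<subseteq> \<O>"
    using reduces_to_nf keys_nf by blast
next
  fix h assume "(reduction_step IX ht T b)\<^sup>*\<^sup>* g h \<and> keys h \<subseteq> \<O>"
  moreover have "nf h = nf g" if "(reduction_step IX ht T b)\<^sup>*\<^sup>* g h"
    using that by (induction rule: rtranclp_induct) (simp_all add: reduction_step_nf)
  ultimately show "h = nf g" using nf_reduced by metis
qed

text \<open>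
  All coefficients arise from those of the tails and of \<open>p\<close> by ring operations.
\<close>

lemma nf_coeffs_closed:
  assumes S: "0 \<in> S" "1 \<in> S" "\<And>x y. x \<in> S \<Longrightarrow> y \<in> S \<Longrightarrow> x + y \<in> S"
      "\<And>x y. x \<in> S \<Longrightarrow> y \<in> S \<Longrightarrow> x * y \<in> S"
    and tails: "\<And>i. i \<in> IX \<Longrightarrow> tail i \<in> coeffs_in S"
    and p: "p \<in> coeffs_in S"
  shows "nf p \<in> coeffs_in S"
proof -
  have sum_closed: "(\<Sum>t\<in>A. single 0 (lookup q t) * f t) \<in> coeffs_in S"
    if "q \<in> coeffs_in S" "\<And>t. t \<in> A \<Longrightarrow> f t \<in> coeffs_in S" for A q and f :: "_ \<Rightarrow> ('v, 'a) mpoly"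
    using that
    by (induction A rule: infinite_finite_induct)
      (auto simp: coeffs_in_def lookup_add lookup_const_times S)
  have "nf_term t \<in> coeffs_in S" for t
  proof (induction t rule: wf_induct_rule[OF wf_term_rel])
    case (1 t)
    show ?case
    proof (cases "t \<in> \<O>")
      case True
      then show ?thesis
        by (simp add: nf_term_in coeffs_in_def lookup_single when_def S)
    next
      case False
      note i = cone_decomp(1)[OF False]
      have "(\<Sum>s\<in>keys (tail (cone_index t)).
        single 0 (lookup (tail (cone_index t)) s) * nf_term (cofactor t + s)) \<in> coeffs_in S"
        using 1 keys_tail'[OF i] term_rel_tail[OF False] by (intro sum_closed[OF tails[OF i]]) blast
      then show ?thesis using False by (subst nf_term.simps) simp
    qed
  qed
  then show ?thesis
    unfolding nf_def extend_def by (intro sum_closed[OF p])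
qed

lemma nf_coeffs_in:
  assumes "ring_module.subspace I" "p \<in> coeffs_in I"
  shows "nf p \<in> coeffs_in I"
  unfolding nf_def by (rule lin_ext_coeffs_in[OF assms])

lemma nf_span_mem:
  assumes "coeff_module.subspace D" "\<And>t i. i \<in> IX \<Longrightarrow> nf (single t 1 * b i) \<in> D"
    and "p \<in> ring_module.span (b ` IX)"
  shows "nf p \<in> D"
  unfolding nf_def by (rule lin_ext_span_mem[OF assms(1) _ assms(3)]) (use assms(2) nf_def in auto)

text \<open>
  The hypotheses say that the common multiple is the least one. The head terms then cancel.
\<close>

lemma S_poly_tails:
  assumes eq: "\<eta> + ht i = \<eta>' + ht j" and disj: "\<And>v. lookup \<eta> v = 0 \<or> lookup \<eta>' v = 0"
  shows "S_poly ht b i j = single \<eta> 1 * b i - single \<eta>' 1 * b j"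
    and "S_poly ht b i j = single \<eta>' 1 * tail j - single \<eta> 1 * tail i"
proof -
  have "tlcm (ht i) (ht j) = \<eta> + ht i"
  proof (rule poly_mapping_eqI)
    fix v
    have "lookup \<eta> v + lookup (ht i) v = lookup \<eta>' v + lookup (ht j) v"
      using arg_cong[OF eq, of "\<lambda>t. lookup t v"] by (simp add: lookup_add)
    then show "lookup (tlcm (ht i) (ht j)) v = lookup (\<eta> + ht i) v"
      using disj[of v] by (auto simp: lookup_tlcm lookup_add)
  qed
  then have "tlcm (ht i) (ht j) - ht i = \<eta>" "tlcm (ht i) (ht j) - ht j = \<eta>'"
    using eq by (metis add_diff_cancel_right')+
  then show S: "S_poly ht b i j = single \<eta> 1 * b i - single \<eta>' 1 * b j"
    by (simp add: S_poly_def)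
  show "S_poly ht b i j = single \<eta>' 1 * tail j - single \<eta> 1 * tail i"
    unfolding S by (simp add: tail_def right_diff_distrib mult_single eq)
qed

end

section \<open>Terms and order ideals\<close>

lemma tdvd_iff: "tdvd s t \<longleftrightarrow> (\<forall>v. lookup s v \<le> lookup t v)"
proof
  assume "\<forall>v. lookup s v \<le> lookup t v"
  then have "t = s + (t - s)"
    by (intro poly_mapping_eqI) (simp add: lookup_add lookup_minus)
  then show "tdvd s t" unfolding tdvd_def by blast
qed (auto simp: tdvd_def lookup_add)

lemma tvar_plus_minus:
  assumes "v \<in> keys t"
  shows "tvar v + (t - tvar v) = t"
  using assms
  by (intro poly_mapping_eqI) (auto simp: tvar_def lookup_add lookup_minus lookup_single when_def in_keys_iff)

lemma tdeg_add:
  fixes s t :: "'v::finite monomial"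
  shows "tdeg (s + t) = tdeg s + tdeg t"
proof -
  have "tdeg u = (\<Sum>v\<in>UNIV. lookup u v)" for u :: "'v monomial"
    unfolding tdeg_def by (rule sum.mono_neutral_left) (auto simp: in_keys_iff)
  then show ?thesis by (simp add: lookup_add sum.distrib)
qed

lemma tdeg_tvar [simp]: "tdeg (tvar v) = 1"
  by (simp add: tdeg_def tvar_def)

lemma tdeg_zero [simp]: "tdeg 0 = 0"
  by (simp add: tdeg_def)

lemma term_induct [case_names zero tvar]:
  fixes t :: "'v::finite monomial"
  assumes "P 0" and "\<And>v t. P t \<Longrightarrow> P (tvar v + t)"
  shows "P t"
proof (induction t rule: measure_induct_rule[of tdeg])
  case (less t)
  show ?case
  proof (cases "t = 0")
    case False
    then obtain v where "v \<in> keys t" by (metis keys_eq_empty ex_in_conv)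
    then have t: "tvar v + (t - tvar v) = t" by (rule tvar_plus_minus)
    then have "tdeg (t - tvar v) < tdeg t"
      using tdeg_add[of "tvar v" "t - tvar v"] by simp
    then show ?thesis using assms(2)[OF less] t by metis
  qed (simp add: assms(1))
qed

lemma tmin_in_keys: "t \<noteq> 0 \<Longrightarrow> tmin t \<in> keys t"
  unfolding tmin_def by (rule Min_in) simp_all

lemma tmin_le: "v \<in> keys t \<Longrightarrow> tmin t \<le> v"
  unfolding tmin_def by simp

text \<open>The lexicographic order, comparing the exponents of the largest variable first.\<close>

definition lex_rel :: "('v::linorder monomial \<times> 'v monomial) set" where
  "lex_rel = {(s, t). \<exists>u. lookup s u < lookup t u \<and> (\<forall>w>u. lookup s w = lookup t w)}"

text \<open>
  There are finitely many variables, so a term is a list of exponents of fixed length, and the order is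
  the lexicographic order on these lists.
\<close>

lemma wf_lex_rel: "wf (lex_rel :: ('v::{finite,linorder} monomial \<times> 'v monomial) set)"
proof -
  let ?vs = "rev (sorted_list_of_set (UNIV :: 'v set))"
  have "(map (lookup s) ?vs, map (lookup t) ?vs) \<in> lenlex less_than"
    if lex: "(s, t) \<in> lex_rel" for s t :: "'v monomial"
  proof -
    obtain u where u: "lookup s u < lookup t u" "\<forall>w>u. lookup s w = lookup t w"
      using lex by (auto simp: lex_rel_def)
    have "u \<in> set ?vs" by simp
    then obtain as bs where split: "?vs = as @ u # bs"
      by (meson split_list)
    have "sorted_wrt (>) ?vs"
      by (simp add: sorted_wrt_rev strict_sorted_iff)
    then have "\<forall>w\<in>set as. u < w"
      unfolding split by (simp add: sorted_wrt_append)
    with u(2) have "map (lookup s) as = map (lookup t) as"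
      by simp
    then have "map (lookup s) ?vs = map (lookup t) as @ lookup s u # map (lookup s) bs"
      "map (lookup t) ?vs = map (lookup t) as @ lookup t u # map (lookup t) bs"
      by (simp_all add: split)
    then show ?thesis
      using u(1) unfolding lenlex_conv lex_conv by fastforce
  qed
  then show ?thesis
    by (intro wf_subset[OF wf_inv_image[OF wf_lenlex[OF wf_less_than],
          of "\<lambda>t. map (lookup t) ?vs"]]) (auto simp: inv_image_def)
qed

lemma lex_rel_total:
  fixes s t :: "'v::{finite,linorder} monomial"
  assumes "s \<noteq> t"
  shows "(s, t) \<in> lex_rel \<or> (t, s) \<in> lex_rel"
proof -
  let ?A = "{v. lookup s v \<noteq> lookup t v}"
  have "?A \<noteq> {}" using assms by (auto intro: poly_mapping_eqI)
  then have max: "Max ?A \<in> ?A" "\<forall>w>Max ?A. w \<notin> ?A"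
    using Max_in[of ?A] Max_ge[of ?A] by (blast intro: finite, meson finite leD)
  then obtain u where u: "lookup s u \<noteq> lookup t u" and above: "\<forall>w>u. lookup s w = lookup t w"
    by blast
  from u consider "lookup s u < lookup t u" | "lookup t u < lookup s u"
    by (rule linorder_neqE)
  then show ?thesis
    using above unfolding lex_rel_def by cases (auto intro: exI[of _ u])
qed

lemma trans_lex_rel: "trans lex_rel"
proof (rule transI)
  fix a b c :: "'v::linorder monomial"
  assume "(a, b) \<in> lex_rel" "(b, c) \<in> lex_rel"
  then obtain u u' where u: "lookup a u < lookup b u" "\<forall>w>u. lookup a w = lookup b w"
    and u': "lookup b u' < lookup c u'" "\<forall>w>u'. lookup b w = lookup c w"
    by (auto simp: lex_rel_def)
  have "lookup a (max u u') < lookup c (max u u')"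
    using u u' by (cases u u' rule: linorder_cases) (auto simp: max_def)
  moreover have "\<forall>w>max u u'. lookup a w = lookup c w"
    using u(2) u'(2) by simp
  ultimately show "(a, c) \<in> lex_rel" unfolding lex_rel_def by blast
qed

lemma lex_rel_add: "(s, t) \<in> lex_rel \<Longrightarrow> (u + s, u + t) \<in> lex_rel"
  by (auto simp: lex_rel_def lookup_add)

lemma order_ideal_closed: "order_ideal \<O> \<Longrightarrow> t \<in> \<O> \<Longrightarrow> (\<And>v. lookup s v \<le> lookup t v) \<Longrightarrow> s \<in> \<O>"
  unfolding order_ideal_def tdvd_iff by blast

lemma order_ideal_zero: "order_ideal \<O> \<Longrightarrow> 0 \<in> \<O>"
  using order_ideal_closed[of \<O> _ 0] by (auto simp: order_ideal_def)

lemma order_ideal_add: "order_ideal \<O> \<Longrightarrow> s \<notin> \<O> \<Longrightarrow> u + s \<notin> \<O>"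
  using order_ideal_closed[of \<O> "u + s" s] by (auto simp: lookup_add)

text \<open>The Pommaret basis without reference to an ideal of polynomials.\<close>

definition pommaret_terms :: "'v::linorder monomial set \<Rightarrow> 'v monomial set" where
  "pommaret_terms \<O> = {t. t \<notin> \<O> \<and> t - tvar (tmin t) \<in> \<O>}"

section \<open>Border cones and Pommaret cones\<close>

locale border_terms =
  fixes \<O> :: "'v::{finite,linorder} monomial set" and \<tau> :: "nat \<Rightarrow> 'v monomial" and m :: nat
  assumes O: "order_ideal \<O>"
    and bij_\<tau>: "bij_betw \<tau> {1..m} (border \<O>)"
    and tdeg_mono: "i \<in> {1..m} \<Longrightarrow> j \<in> {1..m} \<Longrightarrow> i \<le> j \<Longrightarrow> tdeg (\<tau> i) \<le> tdeg (\<tau> j)"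
begin

definition pommaret_index_set :: "nat set" where
  "pommaret_index_set = {i\<in>{1..m}. \<tau> i \<in> pommaret_terms \<O>}"

lemma pommaret_index_setD: "i \<in> pommaret_index_set \<Longrightarrow> i \<in> {1..m}" "i \<in> pommaret_index_set \<Longrightarrow> \<tau> i \<in> pommaret_terms \<O>"
  by (simp_all add: pommaret_index_set_def)

lemma \<tau>_in_border: "i \<in> {1..m} \<Longrightarrow> \<tau> i \<in> border \<O>"
  using bij_\<tau> by (rule bij_betw_apply)

lemma \<tau>_notin: "i \<in> {1..m} \<Longrightarrow> \<tau> i \<notin> \<O>"
  using \<tau>_in_border by (auto simp: border_def)

lemma \<tau>_inj: "i \<in> {1..m} \<Longrightarrow> j \<in> {1..m} \<Longrightarrow> \<tau> i = \<tau> j \<longleftrightarrow> i = j"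
  by (rule inj_on_eq_iff[OF bij_betw_imp_inj_on[OF bij_\<tau>]])

lemma border_index:
  assumes "t \<in> border \<O>"
  obtains i where "i \<in> {1..m}" "\<tau> i = t"
proof -
  have "t \<in> \<tau> ` {1..m}"
    using assms by (simp only: bij_betw_imp_surj_on[OF bij_\<tau>])
  then show ?thesis using that by blast
qed

lemma tvar_plus_border: "s \<in> \<O> \<Longrightarrow> tvar v + s \<notin> \<O> \<Longrightarrow> tvar v + s \<in> border \<O>"
  by (auto simp: border_def)

text \<open>
  Multiply \<open>s\<close> by the variables of \<open>\<eta>\<close> one at a time. The first product outside \<open>\<O>\<close> is a border
  term, and at least one variable has been used up by then.
\<close>

lemma border_divisor:
  assumes "s \<in> \<O>" "\<eta> + s \<notin> \<O>"
  obtains i \<eta>' where "i \<in> {1..m}" "\<eta> + s = \<eta>' + \<tau> i" "tdeg \<eta>' < tdeg \<eta>"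
proof -
  have "\<exists>i\<in>{1..m}. \<exists>\<eta>'. \<eta> + s = \<eta>' + \<tau> i \<and> tdeg \<eta>' < tdeg \<eta>"
    using assms(2)
  proof (induction \<eta> rule: term_induct)
    case zero
    then show ?case using assms(1) by simp
  next
    case (tvar v \<eta>)
    show ?case
    proof (cases "\<eta> + s \<in> \<O>")
      case True
      then have "tvar v + (\<eta> + s) \<in> border \<O>"
        using tvar.prems by (intro tvar_plus_border) (simp_all add: add.assoc)
      then obtain i where "i \<in> {1..m}" "\<tau> i = tvar v + (\<eta> + s)" by (rule border_index)
      then show ?thesis by (intro bexI exI[of _ 0]) (simp_all add: tdeg_add add.assoc)
    next
      case False
      then obtain i \<eta>' where "i \<in> {1..m}" "\<eta> + s = \<eta>' + \<tau> i" "tdeg \<eta>' < tdeg \<eta>"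
        using tvar.IH by blast
      then show ?thesis
        by (intro bexI[of _ i] exI[of _ "tvar v + \<eta>'"]) (simp_all add: tdeg_add add.assoc)
    qed
  qed
  then show ?thesis using that by blast
qed

text \<open>
  A border term with larger index has at least the same degree, so it cannot be a proper divisor.
\<close>

lemma zero_in_border_mult:
  assumes "i \<in> {1..m}"
  shows "0 \<in> border_mult m \<tau> i"
proof -
  have "\<not> tdvd (\<tau> j) (\<tau> i)" if j: "j \<in> {i<..m}" for j
  proof
    assume "tdvd (\<tau> j) (\<tau> i)"
    then obtain u where u: "\<tau> i = \<tau> j + u" by (auto simp: tdvd_def)
    have "tdeg (\<tau> i) \<le> tdeg (\<tau> j)" using assms j by (intro tdeg_mono) auto
    then have "tdeg u = 0" by (simp add: u tdeg_add)
    then have "u = 0"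
      by (simp add: tdeg_def) (metis in_keys_iff keys_eq_empty ex_in_conv)
    then show False using u \<tau>_inj[of i j] assms j by auto
  qed
  then show ?thesis by (simp add: border_mult_def)
qed

lemma pommaret_terms_border: "pommaret_terms \<O> \<subseteq> border \<O>"
proof
  fix t assume t: "t \<in> pommaret_terms \<O>"
  then have "t \<noteq> 0" using order_ideal_zero[OF O] by (auto simp: pommaret_terms_def)
  then have "tvar (tmin t) + (t - tvar (tmin t)) = t"
    by (intro tvar_plus_minus tmin_in_keys)
  with t show "t \<in> border \<O>"
    by (metis (mono_tags, lifting) tvar_plus_border pommaret_terms_def mem_Collect_eq)
qed

text \<open>
  Dividing repeatedly by the smallest variable leads to a Pommaret term. The smallest variables that
  are removed can only increase, so all of them are multiplicative.
\<close>

lemma pommaret_cone_cover: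
  assumes "t \<notin> \<O>"
  shows "\<exists>\<alpha>\<in>pommaret_terms \<O>. \<exists>\<eta>\<in>pommaret_mult \<alpha>. t = \<eta> + \<alpha>"
  using assms
proof (induction t rule: measure_induct_rule[of tdeg])
  case (less t)
  let ?v = "tmin t" and ?t = "t - tvar (tmin t)"
  have "t \<noteq> 0" using less.prems order_ideal_zero[OF O] by auto
  then have t: "tvar ?v + ?t = t" by (intro tvar_plus_minus tmin_in_keys)
  show ?case
  proof (cases "?t \<in> \<O>")
    case True
    then show ?thesis using less.prems
      by (intro bexI[of _ t] bexI[of _ 0]) (auto simp: pommaret_terms_def pommaret_mult_def)
  next
    case False
    have "tdeg ?t < tdeg t" using tdeg_add[of "tvar ?v" ?t] t by simp
    then obtain \<alpha> \<eta> where \<alpha>: "\<alpha> \<in> pommaret_terms \<O>" and \<eta>: "\<eta> \<in> pommaret_mult \<alpha>" and eq: "?t = \<eta> + \<alpha>"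
      using less.IH False by blast
    have t': "t = tvar ?v + \<eta> + \<alpha>" using t eq by (metis add.assoc)
    have "\<alpha> \<noteq> 0" using \<alpha> order_ideal_zero[OF O] by (auto simp: pommaret_terms_def)
    then have "tmin \<alpha> \<in> keys t"
      by (subst t') (use tmin_in_keys[of \<alpha>] in \<open>auto simp: in_keys_iff lookup_add\<close>)
    then have "?v \<le> tmin \<alpha>" by (rule tmin_le)
    then have "tvar ?v + \<eta> \<in> pommaret_mult \<alpha>"
      using \<eta> Poly_Mapping.keys_add[of "tvar ?v" \<eta>] by (auto simp: pommaret_mult_def tvar_def)
    then show ?thesis using \<alpha> t' by blast
  qed
qed

text \<open>
  The combinatorial core of the Pommaret structure. Suppose that \<open>\<eta>'\<close> is larger than \<open>\<eta>\<close> and let \<open>u\<close> be the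
  largest variable in which they differ. As \<open>u\<close> is multiplicative for \<open>\<alpha>\<close>, no smaller variable
  divides \<open>\<alpha>\<close>. Comparing exponents, \<open>\<alpha>\<close> divides \<open>s\<close>, with a smaller exponent at \<open>u\<close>; so \<open>\<alpha>\<close> even divides the
  quotient of \<open>s\<close> by its smallest variable. Then \<open>\<alpha>\<close> would belong to \<open>\<O>\<close>.
  For \<open>s\<close> in \<open>\<O>\<close> this makes reduction terminate; for a Pommaret term \<open>s\<close> it shows that cones are
  disjoint and that S-polynomials have small multipliers.
\<close>

lemma pommaret_cone_lex:
  assumes eq: "\<eta> + s = \<eta>' + \<alpha>" and \<eta>': "\<eta>' \<in> pommaret_mult \<alpha>" and \<alpha>: "\<alpha> \<notin> \<O>"
    and s: "s \<in> \<O> \<union> pommaret_terms \<O>"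
  shows "(\<eta>', \<eta>) \<in> lex_rel \<or> \<eta>' = \<eta>"
proof (rule ccontr)
  assume "\<not> ?thesis"
  then have "(\<eta>, \<eta>') \<in> lex_rel" using lex_rel_total[of \<eta> \<eta>'] by auto
  then obtain u where u: "lookup \<eta> u < lookup \<eta>' u" "\<forall>w>u. lookup \<eta> w = lookup \<eta>' w"
    by (auto simp: lex_rel_def)
  have eq': "lookup \<eta> w + lookup s w = lookup \<eta>' w + lookup \<alpha> w" for w
    using arg_cong[OF eq, of "\<lambda>t. lookup t w"] by (simp add: lookup_add)
  have "u \<le> tmin \<alpha>"
    using \<eta>' u(1) by (auto simp: pommaret_mult_def in_keys_iff)
  then have below: "lookup \<alpha> w = 0" if "w < u" for w
    using tmin_le[of w \<alpha>] that by (metis in_keys_iff order_trans leD)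
  have at: "lookup \<alpha> u < lookup s u" using u(1) eq'[of u] by simp
  have above: "lookup \<alpha> w = lookup s w" if "w > u" for w using u(2) eq'[of w] that by simp
  show False
  proof (cases "s \<in> \<O>")
    case True
    have "lookup \<alpha> w \<le> lookup s w" for w
      using below[of w] at above[of w] by (cases w u rule: linorder_cases) auto
    then show False using order_ideal_closed[OF O True] \<alpha> by blast
  next
    case False
    let ?x = "tmin s"
    have "?x \<le> u" using at by (intro tmin_le) (simp add: in_keys_iff)
    then have "lookup \<alpha> w \<le> lookup (s - tvar ?x) w" for w
      using below[of w] at above[of w]
      by (cases w u rule: linorder_cases) (auto simp: lookup_minus tvar_def lookup_single when_def)
    moreover have "s - tvar ?x \<in> \<O>" using s False by (auto simp: pommaret_terms_def)
    ultimately show False using order_ideal_closed[OF O] \<alpha> by blast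
  qed
qed

end

locale marked_set = border_terms \<O> \<tau> m
  for \<O> :: "'v::{finite,linorder} monomial set" and \<tau> :: "nat \<Rightarrow> 'v monomial" and m :: nat +
  fixes b :: "nat \<Rightarrow> ('v, 'a::comm_ring_1) mpoly"
  assumes tail_subset: "i \<in> {1..m} \<Longrightarrow> keys (single (\<tau> i) 1 - b i) \<subseteq> \<O>"

text \<open>
  The cone of a term is that of the border term with the largest index dividing it, which has the
  largest degree among the border terms dividing it. Replacing a head term by a tail term therefore
  lowers the degree of the multiplier.
\<close>

sublocale marked_set \<subseteq> border: marked_structure \<O> "{1..m}" \<tau> "border_mult m \<tau>" b "measure tdeg"
proof
  fix t assume t: "t \<notin> \<O>"
  let ?A = "{i\<in>{1..m}. tdvd (\<tau> i) t}"
  have "t + 0 \<notin> \<O>" using t by simp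
  then obtain i \<eta> where "i \<in> {1..m}" "t + 0 = \<eta> + \<tau> i"
    by (rule border_divisor[OF order_ideal_zero[OF O]])
  then have "i \<in> ?A" by (auto simp: tdvd_def add.commute)
  then have max: "Max ?A \<in> ?A" by (intro Max_in) auto
  then obtain \<eta> where \<eta>: "t = \<tau> (Max ?A) + \<eta>" by (auto simp: tdvd_def)
  have "\<eta> \<in> border_mult m \<tau> (Max ?A)"
    unfolding border_mult_def
  proof (intro CollectI ballI notI)
    fix j assume j: "j \<in> {Max ?A<..m}" "tdvd (\<tau> j) (\<tau> (Max ?A) + \<eta>)"
    then have "j \<in> ?A" unfolding \<eta>[symmetric] by simp
    then have "j \<le> Max ?A" by (intro Max_ge) auto
    then show False using j(1) by simp
  qed
  with \<eta> max show "\<exists>i\<in>{1..m}. \<exists>\<eta>\<in>border_mult m \<tau> i. t = \<eta> + \<tau> i"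
    by (metis (no_types, lifting) add.commute mem_Collect_eq)
next
  fix i \<eta> assume "i \<in> {1..m}"
  then show "\<eta> + \<tau> i \<notin> \<O>" by (intro order_ideal_add[OF O] \<tau>_notin)
next
  have *: "\<not> i < j" if "i \<in> {1..m}" "j \<in> {1..m}" "\<eta> \<in> border_mult m \<tau> i"
    "\<eta> + \<tau> i = \<eta>' + \<tau> j" for i j \<eta> \<eta>'
  proof
    assume "i < j"
    moreover have "tdvd (\<tau> j) (\<tau> i + \<eta>)"
      using that(4) by (auto simp: tdvd_def add.commute)
    ultimately show False using that by (auto simp: border_mult_def)
  qed
  fix i j \<eta> \<eta>'
  assume "i \<in> {1..m}" "j \<in> {1..m}" "\<eta> \<in> border_mult m \<tau> i" "\<eta>' \<in> border_mult m \<tau> j"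
    "\<eta> + \<tau> i = \<eta>' + \<tau> j"
  then show "i = j" using *[of i j \<eta> \<eta>'] *[of j i \<eta>' \<eta>] by auto
next
  fix i assume "i \<in> {1..m}"
  then show "keys (single (\<tau> i) 1 - b i) \<subseteq> \<O>" by (rule tail_subset)
next
  show "wf (measure tdeg)" by simp
next
  fix i j \<eta> \<eta>' s
  assume *: "i \<in> {1..m}" "j \<in> {1..m}" "\<eta>' \<in> border_mult m \<tau> j" "s \<in> \<O>" "\<eta> + s = \<eta>' + \<tau> j"
  then have "\<eta> + s \<notin> \<O>" by (metis order_ideal_add[OF O] \<tau>_notin)
  then obtain k \<mu> where k: "k \<in> {1..m}" "\<eta> + s = \<mu> + \<tau> k" "tdeg \<mu> < tdeg \<eta>"
    by (rule border_divisor[OF *(4)])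
  have "tdvd (\<tau> k) (\<tau> j + \<eta>')"
    using k(2) *(5) by (auto simp: tdvd_def add.commute)
  then have "k \<le> j" using *(3) k(1) by (auto simp: border_mult_def not_le[symmetric])
  then have "tdeg (\<tau> k) \<le> tdeg (\<tau> j)" using tdeg_mono k(1) *(2) by blast
  moreover have "tdeg \<mu> + tdeg (\<tau> k) = tdeg \<eta>' + tdeg (\<tau> j)"
    using k(2) *(5) by (metis tdeg_add)
  ultimately show "(\<eta>', \<eta>) \<in> measure tdeg" using k(3) by simp
qed

text \<open>
  Degrees of multipliers may grow in a Pommaret reduction; the lexicographic order decreases.
\<close>

sublocale marked_set \<subseteq> pommaret: marked_structure \<O> pommaret_index_set \<tau>
  "\<lambda>i. pommaret_mult (\<tau> i)" b lex_rel
proof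
  fix t assume "t \<notin> \<O>"
  then obtain \<alpha> \<eta> where *: "\<alpha> \<in> pommaret_terms \<O>" "\<eta> \<in> pommaret_mult \<alpha>" "t = \<eta> + \<alpha>"
    using pommaret_cone_cover by blast
  then obtain i where "i \<in> {1..m}" "\<tau> i = \<alpha>"
    using pommaret_terms_border border_index by blast
  with * show "\<exists>i\<in>pommaret_index_set. \<exists>\<eta>\<in>pommaret_mult (\<tau> i). t = \<eta> + \<tau> i"
    unfolding pommaret_index_set_def by blast
next
  fix i \<eta> assume "i \<in> pommaret_index_set"
  then show "\<eta> + \<tau> i \<notin> \<O>" by (intro order_ideal_add[OF O] \<tau>_notin pommaret_index_setD)
next
  fix i j \<eta> \<eta>'
  assume i: "i \<in> pommaret_index_set" and j: "j \<in> pommaret_index_set"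
    and \<eta>: "\<eta> \<in> pommaret_mult (\<tau> i)" "\<eta>' \<in> pommaret_mult (\<tau> j)"
    and eq: "\<eta> + \<tau> i = \<eta>' + \<tau> j"
  have "(\<eta>', \<eta>) \<in> lex_rel \<or> \<eta>' = \<eta>" "(\<eta>, \<eta>') \<in> lex_rel \<or> \<eta> = \<eta>'"
    using pommaret_cone_lex[OF eq \<eta>(2)] pommaret_cone_lex[OF eq[symmetric] \<eta>(1)]
      pommaret_index_setD[OF i] pommaret_index_setD[OF j] \<tau>_notin by auto
  then have "\<eta>' = \<eta>"
    using wf_not_sym[OF wf_lex_rel] by blast
  then show "i = j" using eq pommaret_index_setD(1)[OF i] pommaret_index_setD(1)[OF j] \<tau>_inj by simp
next
  fix i assume "i \<in> pommaret_index_set"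
  then show "keys (single (\<tau> i) 1 - b i) \<subseteq> \<O>" by (intro tail_subset pommaret_index_setD)
next
  show "wf (lex_rel :: ('v monomial \<times> 'v monomial) set)" by (rule wf_lex_rel)
next
  fix i j \<eta> \<eta>' s
  assume j: "j \<in> pommaret_index_set"
    and \<eta>': "\<eta>' \<in> pommaret_mult (\<tau> j)" and s: "s \<in> \<O>" and eq: "\<eta> + s = \<eta>' + \<tau> j"
  have "\<eta>' \<noteq> \<eta>" using eq s \<tau>_notin[OF pommaret_index_setD(1)[OF j]] by auto
  then show "(\<eta>', \<eta>) \<in> lex_rel"
    using pommaret_cone_lex[OF eq \<eta>'] s \<tau>_notin[OF pommaret_index_setD(1)[OF j]] by auto
qed

section \<open>The criterion for Pommaret marked sets\<close>

context marked_set
begin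

text \<open>
  The multiplier \<open>\<mu>\<close> is smaller than \<open>x\<^sub>v\<close>, so \<open>x\<^sub>v\<close> does not divide \<open>\<mu>\<close>, and the two products are the
  least common multiple of the head terms.
\<close>

lemma nonmultiplicative_step:
  assumes i: "i \<in> pommaret_index_set" and v: "tvar v \<notin> pommaret_mult (\<tau> i)"
  obtains j \<mu> where "j \<in> pommaret_index_set" "\<mu> \<in> pommaret_mult (\<tau> j)" "tvar v + \<tau> i = \<mu> + \<tau> j"
    "(\<mu>, tvar v) \<in> lex_rel" "nonmultiplicative_couple (\<tau> i) (\<tau> j)"
    "S_poly \<tau> b i j = single (tvar v) 1 * b i - single \<mu> 1 * b j"
    "S_poly \<tau> b i j = single \<mu> 1 * pommaret.tail j - single (tvar v) 1 * pommaret.tail i"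
proof -
  have "tvar v + \<tau> i \<notin> \<O>" by (intro order_ideal_add[OF O] \<tau>_notin pommaret_index_setD(1)[OF i])
  from pommaret.cone_cover[OF this] obtain j \<mu> where j: "j \<in> pommaret_index_set"
    and \<mu>: "\<mu> \<in> pommaret_mult (\<tau> j)" and eq: "tvar v + \<tau> i = \<mu> + \<tau> j"
    by blast
  have "\<mu> \<noteq> tvar v"
  proof
    assume "\<mu> = tvar v"
    then have "\<tau> i = \<tau> j" using eq by simp
    then show False using v \<mu> \<open>\<mu> = tvar v\<close> by simp
  qed
  then have less: "(\<mu>, tvar v) \<in> lex_rel"
    using pommaret_cone_lex[OF eq \<mu>] pommaret_index_setD(2)[OF i] \<tau>_notin[OF pommaret_index_setD(1)[OF j]] by auto
  then obtain u where u: "lookup \<mu> u < lookup (tvar v) u" "\<forall>w>u. lookup \<mu> w = lookup (tvar v) w"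
    by (auto simp: lex_rel_def)
  have "u = v" using u(1) by (auto simp: tvar_def lookup_single when_def split: if_splits)
  with u(1) have "lookup \<mu> v = 0" by (simp add: tvar_def)
  then have disj: "lookup (tvar v) w = 0 \<or> lookup \<mu> w = 0" for w
    by (auto simp: tvar_def lookup_single when_def)
  have "tvar v + \<tau> i \<in> pommaret_cone (\<tau> j)"
    unfolding pommaret_cone_def using \<mu> eq by blast
  then have "nonmultiplicative_couple (\<tau> i) (\<tau> j)"
    unfolding nonmultiplicative_couple_def using v by blast
  then show ?thesis
    using that[OF j \<mu> eq less] pommaret.S_poly_tails[OF eq disj] by blast
qed

text \<open>
  Well-founded induction on the term \<open>t\<close> shows that \<open>nf (t b i)\<close> has coefficients in \<open>I\<close>. If \<open>t\<close> is not
  multiplicative, write \<open>t = t' x\<^sub>v\<close> with \<open>x\<^sub>v\<close> not multiplicative. Modulo \<open>I\<close>, the polynomial \<open>x\<^sub>v b i\<close> is a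
  combination of products \<open>\<eta> b j\<close> with \<open>\<eta>\<close> smaller than \<open>x\<^sub>v\<close>, and the terms \<open>t' \<eta>\<close> are smaller than \<open>t\<close>.
\<close>

lemma pommaret_criterion:
  assumes I: "ring_module.subspace I"
    and S: "\<And>i j. i \<in> pommaret_index_set \<Longrightarrow> j \<in> pommaret_index_set \<Longrightarrow>
      nonmultiplicative_couple (\<tau> i) (\<tau> j) \<Longrightarrow> pommaret.nf (S_poly \<tau> b i j) \<in> coeffs_in I"
    and p: "p \<in> ring_module.span (b ` pommaret_index_set)"
  shows "pommaret.nf p \<in> coeffs_in I"
proof (rule pommaret.nf_span_mem[OF subspace_coeffs_in[OF I] _ p])
  note V = subspace_coeffs_in[OF I]
  show "pommaret.nf (single t 1 * b i) \<in> coeffs_in I" if "i \<in> pommaret_index_set" for t i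
    using that
  proof (induction t arbitrary: i rule: wf_induct_rule[OF wf_lex_rel])
    case (1 t)
    show ?case
    proof (cases "t \<in> pommaret_mult (\<tau> i)")
      case True
      then show ?thesis
        using 1(2) by (simp add: pommaret.nf_marked coeff_module.subspace_0[OF V])
    next
      case False
      then obtain v where v: "v \<in> keys t" "\<not> v \<le> tmin (\<tau> i)"
        by (auto simp: pommaret_mult_def)
      have "tvar v \<notin> pommaret_mult (\<tau> i)" using v(2) by (simp add: pommaret_mult_def tvar_def)
      then obtain j \<mu> where j: "j \<in> pommaret_index_set" and \<mu>: "\<mu> \<in> pommaret_mult (\<tau> j)"
        and less: "(\<mu>, tvar v) \<in> lex_rel" and couple: "nonmultiplicative_couple (\<tau> i) (\<tau> j)"
        and S_eq: "S_poly \<tau> b i j = single (tvar v) 1 * b i - single \<mu> 1 * b j"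
        and S_tails: "S_poly \<tau> b i j =
          single \<mu> 1 * pommaret.tail j - single (tvar v) 1 * pommaret.tail i"
        using nonmultiplicative_step[OF 1(2)] by metis
      let ?S = "S_poly \<tau> b i j" and ?t = "t - tvar v"
      have t: "t = ?t + tvar v" using tvar_plus_minus[OF v(1)] by (simp add: add.commute)
      have IH: "pommaret.nf (single (?t + \<eta>) 1 * b k) \<in> coeffs_in I"
        if "(\<eta>, tvar v) \<in> lex_rel" "k \<in> pommaret_index_set" for \<eta> k
      proof (rule 1(1)[OF _ that(2)])
        show "(?t + \<eta>, t) \<in> lex_rel" by (subst (2) t) (rule lex_rel_add[OF that(1)])
      qed
      let ?D = "{p. pommaret.nf (single ?t 1 * p) \<in> coeffs_in I}"
      have D: "coeff_module.subspace ?D"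
        unfolding pommaret.nf_def by (rule subspace_vimage_lin_ext[OF V])
      have "?S - pommaret.nf ?S \<in> ?D"
      proof (rule pommaret.diff_nf_mem[OF D, where Q = "\<lambda>\<eta>. (\<eta>, tvar v) \<in> lex_rel"])
        show "(\<eta>', tvar v) \<in> lex_rel" if "(\<eta>, tvar v) \<in> lex_rel" "(\<eta>', \<eta>) \<in> lex_rel" for \<eta> \<eta>'
          using transD[OF trans_lex_rel that(2,1)] .
        show "single \<eta> 1 * b k \<in> ?D" if "k \<in> pommaret_index_set" "(\<eta>, tvar v) \<in> lex_rel" for k \<eta>
          using IH[OF that(2,1)] by (simp add: single_times_single_times)
        show "(pommaret.cofactor u, tvar v) \<in> lex_rel" if u: "u \<in> keys ?S" "u \<notin> \<O>" for u
        proof -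
          have "u \<in> keys (single \<mu> 1 * pommaret.tail j) \<union> keys (single (tvar v) 1 * pommaret.tail i)"
            using subsetD[OF keys_diff] u(1) unfolding S_tails .
          then have "\<exists>\<eta>\<in>{\<mu>, tvar v}. \<exists>s\<in>\<O>. u = \<eta> + s"
            using keys_single_timesD[OF _ pommaret.keys_tail'[OF j], of u \<mu> 1]
              keys_single_timesD[OF _ pommaret.keys_tail'[OF 1(2)], of u "tvar v" 1] by blast
          then obtain \<eta> s where \<eta>: "\<eta> = \<mu> \<or> \<eta> = tvar v" and us: "u = \<eta> + s" and s: "s \<in> \<O>"
            by blast
          note decomp = pommaret.cone_decomp[OF u(2)]
          have eq: "\<eta> + s = pommaret.cofactor u + \<tau> (pommaret.cone_index u)"
            using decomp(3) us by simp
          have "pommaret.cofactor u \<noteq> \<eta>" using eq s \<tau>_notin[OF pommaret_index_setD(1)[OF decomp(1)]] by auto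
          then have "(pommaret.cofactor u, \<eta>) \<in> lex_rel"
            using pommaret_cone_lex[OF eq decomp(2)] s \<tau>_notin[OF pommaret_index_setD(1)[OF decomp(1)]] by auto
          then show ?thesis using \<eta> less transD[OF trans_lex_rel] by blast
        qed
      qed
      moreover have "pommaret.nf ?S \<in> ?D"
        using S[OF 1(2) j couple] by (simp add: pommaret.nf_coeffs_in times_coeffs_in I)
      moreover have "single \<mu> 1 * b j \<in> ?D"
        using IH[OF less j] by (simp add: single_times_single_times)
      ultimately have "(?S - pommaret.nf ?S) + pommaret.nf ?S + single \<mu> 1 * b j \<in> ?D"
        by (intro coeff_module.subspace_add[OF D])
      then have "single (tvar v) 1 * b i \<in> ?D"
        by (simp add: S_eq)
      then have "pommaret.nf (single (?t + tvar v) 1 * b i) \<in> coeffs_in I"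
        by (simp add: single_times_single_times)
      then show ?thesis using t by simp
    qed
  qed
qed

section \<open>The criterion for border marked sets\<close>

text \<open>On polynomials supported on \<open>\<O>\<close>, this is the formal multiplication matrix of the variable.\<close>

definition mul_var :: "'v \<Rightarrow> ('v, 'a) mpoly \<Rightarrow> ('v, 'a) mpoly" where
  "mul_var v p = border.nf (single (tvar v) 1 * p)"

lemma additive_mul_var: "additive (mul_var v)"
  by unfold_locales (simp add: mul_var_def distrib_left border.nf_add)

lemma mul_var_scale: "mul_var v (single 0 c * p) = single 0 c * mul_var v p"
  unfolding mul_var_def by (simp only: mult.left_commute[of "single (tvar v) 1"] border.nf_scale)

lemma mul_var_single: "mul_var v (single s 1) = border.nf_term (tvar v + s)"
  by (simp add: mul_var_def mult_single border.nf_monomial)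

lemmas nf_term_border = border.nf_term_head[OF _ zero_in_border_mult]

lemma nf_S_poly_border:
  assumes "i \<in> {1..m}" "j \<in> {1..m}" "\<eta> + \<tau> i = \<eta>' + \<tau> j"
    and "\<And>v. lookup \<eta> v = 0 \<or> lookup \<eta>' v = 0"
  shows "border.nf (S_poly \<tau> b i j)
    = border.nf (single \<eta>' 1 * border.tail j) - border.nf (single \<eta> 1 * border.tail i)"
  by (simp add: border.S_poly_tails(2)[OF assms(3,4)] border.nf_diff)

text \<open>
  If exactly one of \<open>x\<^sub>u s\<close> and \<open>x\<^sub>v s\<close> is in \<open>\<O>\<close>, the other one, \<open>\<tau> k\<close>, has the border term \<open>x\<^sub>u x\<^sub>v s\<close> as a
  multiple, and the two form a neighbour couple. If both are outside \<open>\<O>\<close>, they are neighbours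
  themselves. In either case the commutator is, up to sign, the normal form of the S-polynomial.
\<close>

lemma mul_var_commute_term:
  assumes I: "ring_module.subspace I"
    and S: "\<And>i j. i \<in> {1..m} \<Longrightarrow> j \<in> {1..m} \<Longrightarrow> neighbour_couple (\<tau> i) (\<tau> j) \<Longrightarrow>
      border.nf (S_poly \<tau> b i j) \<in> coeffs_in I"
    and s: "s \<in> \<O>"
  shows "mul_var u (mul_var v (single s 1)) - mul_var v (mul_var u (single s 1)) \<in> coeffs_in I"
proof -
  note V = subspace_coeffs_in[OF I]
  have mixed: "mul_var v (mul_var u (single s 1)) - mul_var u (mul_var v (single s 1)) \<in> coeffs_in I"
    if v: "tvar v + s \<in> \<O>" and u: "tvar u + s \<notin> \<O>" for u v
  proof -
    obtain k where k: "k \<in> {1..m}" "\<tau> k = tvar u + s"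
      using border_index[OF tvar_plus_border[OF s u]] .
    have "tvar u + (tvar v + s) \<notin> \<O>"
      using order_ideal_add[OF O u, of "tvar v"] by (simp add: add.left_commute)
    then obtain r where r: "r \<in> {1..m}" "\<tau> r = tvar u + (tvar v + s)"
      using border_index[OF tvar_plus_border[OF v]] by metis
    have eq: "0 + \<tau> r = tvar v + \<tau> k" using r k by (simp add: add.left_commute)
    have "border.nf (S_poly \<tau> b r k) = mul_var v (border.tail k) - border.tail r"
      using nf_S_poly_border[OF r(1) k(1) eq] border.nf_reduced[OF border.keys_tail'[OF r(1)]]
      by (simp add: mul_var_def)
    moreover have "neighbour_couple (\<tau> r) (\<tau> k)"
      unfolding neighbour_couple_def using eq by auto
    ultimately have "mul_var v (border.tail k) - border.tail r \<in> coeffs_in I"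
      using S[OF r(1) k(1)] by simp
    moreover have "mul_var u (single s 1) = border.tail k"
      using nf_term_border[OF k(1) k(1)] k(2) by (simp add: mul_var_single)
    moreover have "mul_var u (mul_var v (single s 1)) = border.tail r"
      using nf_term_border[OF r(1) r(1)] r(2) v by (simp add: mul_var_single border.nf_term_in)
    ultimately show ?thesis by simp
  qed
  show ?thesis
  proof (cases "tvar u + s \<in> \<O>")
    case u: True
    show ?thesis
    proof (cases "tvar v + s \<in> \<O>")
      case True
      then show ?thesis
        using u by (simp add: mul_var_single border.nf_term_in add.left_commute coeff_module.subspace_0[OF V])
    next
      case False
      then show ?thesis by (rule mixed[OF u])
    qed
  next
    case u: False
    show ?thesis
    proof (cases "tvar v + s \<in> \<O>")
      case True
      show ?thesis
        using coeff_module.subspace_neg[OF V mixed[OF True u]] by simp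
    next
      case v: False
      obtain i where i: "i \<in> {1..m}" "\<tau> i = tvar u + s"
        using border_index[OF tvar_plus_border[OF s u]] .
      obtain j where j: "j \<in> {1..m}" "\<tau> j = tvar v + s"
        using border_index[OF tvar_plus_border[OF s v]] .
      have ui: "mul_var u (single s 1) = border.tail i" and vj: "mul_var v (single s 1) = border.tail j"
        using nf_term_border[OF i(1) i(1)] nf_term_border[OF j(1) j(1)] i(2) j(2) by (simp_all add: mul_var_single)
      show ?thesis
      proof (cases "u = v")
        case True
        then show ?thesis by (simp add: coeff_module.subspace_0[OF V])
      next
        case False
        have eq: "tvar v + \<tau> i = tvar u + \<tau> j" using i j by (simp add: add.left_commute)
        have "lookup (tvar v) w = 0 \<or> lookup (tvar u) w = 0" for w
          using False by (auto simp: tvar_def lookup_single when_def)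
        then have "border.nf (S_poly \<tau> b i j) = mul_var u (border.tail j) - mul_var v (border.tail i)"
          using nf_S_poly_border[OF i(1) j(1) eq] by (simp add: mul_var_def)
        moreover have "neighbour_couple (\<tau> i) (\<tau> j)"
          unfolding neighbour_couple_def using eq by blast
        ultimately show ?thesis using S[OF i(1) j(1)] by (simp add: ui vj)
      qed
    qed
  qed
qed

text \<open>
  The action of \<open>t\<close> on 1 by the formal multiplication matrices. Since these commute only modulo an
  ideal, an order of the variables has to be chosen.
\<close>

function mul_vars :: "'v monomial \<Rightarrow> ('v, 'a) mpoly" where
  "mul_vars t = (if t = 0 then 1 else mul_var (tmin t) (mul_vars (t - tvar (tmin t))))"
  by auto
termination
proof (relation "measure tdeg", simp)
  fix t :: "'v monomial" assume "t \<noteq> 0"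
  then have "tvar (tmin t) + (t - tvar (tmin t)) = t" by (intro tvar_plus_minus tmin_in_keys)
  then show "(t - tvar (tmin t), t) \<in> measure tdeg"
    using tdeg_add[of "tvar (tmin t)" "t - tvar (tmin t)"] by simp
qed

declare mul_vars.simps [simp del]

text \<open>
  Let \<open>E\<close> be the linear extension of \<open>mul_vars\<close>. As the multiplication matrices commute modulo \<open>I\<close>, the
  map \<open>E\<close> is linear over the polynomial ring modulo \<open>I\<close>. It kills each \<open>b i\<close>, hence the ideal \<open>(b)\<close>, modulo
  \<open>I\<close>, and it is the identity on polynomials supported on \<open>\<O>\<close>. As \<open>p - nf p\<close> is in \<open>(b)\<close>, it follows that
  \<open>nf p = E (nf p) = E p = 0\<close> modulo \<open>I\<close>.
\<close>

lemma border_criterion: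
  assumes I: "ring_module.subspace I"
    and S: "\<And>i j. i \<in> {1..m} \<Longrightarrow> j \<in> {1..m} \<Longrightarrow> neighbour_couple (\<tau> i) (\<tau> j) \<Longrightarrow>
      border.nf (S_poly \<tau> b i j) \<in> coeffs_in I"
    and p: "p \<in> ring_module.span (b ` {1..m})"
  shows "border.nf p \<in> coeffs_in I"
proof -
  note V = subspace_coeffs_in[OF I]
  let ?V = "coeffs_in I :: ('v, 'a) mpoly set"
  have mul_var_V: "mul_var v h \<in> ?V" if "h \<in> ?V" for v h
    unfolding mul_var_def using that by (intro border.nf_coeffs_in times_coeffs_in I)
  have mul_var_cong: "mul_var v h - mul_var v h' \<in> ?V" if "h - h' \<in> ?V" for v h h'
    using mul_var_V[OF that] by (simp add: additive.diff[OF additive_mul_var])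
  have trans: "h - h'' \<in> ?V" if "h - h' \<in> ?V" "h' - h'' \<in> ?V" for h h' h''
    using coeff_module.subspace_add[OF V that] by simp
  have commute: "mul_var u (mul_var v h) - mul_var v (mul_var u h) \<in> ?V"
    if h: "keys h \<subseteq> \<O>" for u v h
  proof -
    let ?D = "{h. mul_var u (mul_var v h) - mul_var v (mul_var u h) \<in> ?V}"
    have "coeff_module.subspace ?D"
    proof (rule coeff_module.subspaceI)
      show "0 \<in> ?D"
        by (simp add: additive.zero[OF additive_mul_var] coeff_module.subspace_0[OF V])
      show "x + y \<in> ?D" if "x \<in> ?D" "y \<in> ?D" for x y
        using coeff_module.subspace_add[OF V, of "mul_var u (mul_var v x) - mul_var v (mul_var u x)"
            "mul_var u (mul_var v y) - mul_var v (mul_var u y)"] that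
        by (simp add: additive.add[OF additive_mul_var] algebra_simps)
      show "single 0 c * x \<in> ?D" if "x \<in> ?D" for c x
        using coeff_module.subspace_scale[OF V, of "mul_var u (mul_var v x) - mul_var v (mul_var u x)" c] that
        by (simp add: mul_var_scale right_diff_distrib)
    qed
    moreover have "single s 1 \<in> ?D" if "s \<in> keys h" for s
      using mul_var_commute_term[OF I S, of s u v] that h by blast
    ultimately have "h \<in> ?D" by (rule coeff_subspace_memI)
    then show ?thesis by simp
  qed
  have keys_mul_vars: "keys (mul_vars t) \<subseteq> \<O>" for t
    using order_ideal_zero[OF O] border.keys_nf by (subst mul_vars.simps) (auto simp: mul_var_def)
  have step: "mul_vars (tvar v + t) - mul_var v (mul_vars t) \<in> ?V" for v t
  proof (induction t arbitrary: v rule: measure_induct_rule[of tdeg])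
    case (less t)
    let ?w = "tmin (tvar v + t)"
    have "tdeg (tvar v + t) \<noteq> 0" by (simp add: tdeg_add)
    then have nz: "tvar v + t \<noteq> 0" by (metis tdeg_zero)
    have unfold: "mul_vars (tvar v + t) = mul_var ?w (mul_vars (tvar v + t - tvar ?w))"
      by (subst mul_vars.simps) (simp add: nz)
    show ?case
    proof (cases "?w = v")
      case True
      then show ?thesis using unfold by (simp add: coeff_module.subspace_0[OF V])
    next
      case False
      have "?w \<in> keys t"
        using tmin_in_keys[OF nz] False by (auto simp: in_keys_iff lookup_add tvar_def lookup_single when_def)
      then have t: "tvar ?w + (t - tvar ?w) = t" by (rule tvar_plus_minus)
      define w t' where "w = ?w" and "t' = t - tvar ?w"
      have t_eq: "t = tvar w + t'" using t by (simp add: w_def t'_def)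
      have less': "tdeg t' < tdeg t" by (simp add: t_eq tdeg_add)
      have "tvar v + t - tvar w = tvar v + t'"
        by (simp add: t_eq add.left_commute[of "tvar v"])
      then have 1: "mul_vars (tvar v + t) = mul_var w (mul_vars (tvar v + t'))"
        using unfold by (simp add: w_def)
      have "mul_var w (mul_vars (tvar v + t')) - mul_var w (mul_var v (mul_vars t')) \<in> ?V"
        by (rule mul_var_cong[OF less.IH[OF less']])
      moreover have "mul_var w (mul_var v (mul_vars t')) - mul_var v (mul_var w (mul_vars t')) \<in> ?V"
        by (rule commute[OF keys_mul_vars])
      moreover have "mul_var v (mul_var w (mul_vars t')) - mul_var v (mul_vars t) \<in> ?V"
        using coeff_module.subspace_neg[OF V mul_var_cong[OF less.IH[OF less', of w], of v]]
        by (simp add: t_eq)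
      ultimately show ?thesis unfolding 1 using trans by blast
    qed
  qed
  have mul_vars_in: "mul_vars t = single t 1" if "t \<in> \<O>" for t
    using that
  proof (induction t rule: measure_induct_rule[of tdeg])
    case (less t)
    show ?case
    proof (cases "t = 0")
      case True
      then show ?thesis by (simp add: mul_vars.simps)
    next
      case False
      then have t: "tvar (tmin t) + (t - tvar (tmin t)) = t" by (intro tvar_plus_minus tmin_in_keys)
      then have "tdeg (t - tvar (tmin t)) < tdeg t"
        using tdeg_add[of "tvar (tmin t)" "t - tvar (tmin t)"] by simp
      moreover have "t - tvar (tmin t) \<in> \<O>"
        using order_ideal_closed[OF O less.prems] by (simp add: lookup_minus)
      ultimately have "mul_vars (t - tvar (tmin t)) = single (t - tvar (tmin t)) 1"
        using less.IH by blast
      then show ?thesis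
        using False t less.prems by (subst mul_vars.simps) (simp add: mul_var_single border.nf_term_in)
    qed
  qed
  let ?E = "lin_ext mul_vars"
  have E_reduced: "?E h = h" if "keys h \<subseteq> \<O>" for h
    using that mul_vars_in by (intro lin_ext_id) blast
  have E_step: "?E (single (tvar v) 1 * q) - mul_var v (?E q) \<in> ?V" for v q
  proof (induction q rule: poly_mapping_single_induct)
    case (single t a)
    have "?E (single (tvar v) 1 * single t a) - mul_var v (?E (single t a))
      = single 0 a * (mul_vars (tvar v + t) - mul_var v (mul_vars t))"
      by (simp add: mult_single lin_ext_single mul_var_scale right_diff_distrib)
    then show ?case using coeff_module.subspace_scale[OF V step] by simp
  next
    case (add q q')
    then show ?case
      using coeff_module.subspace_add[OF V add.IH]
      by (simp add: distrib_left additive.add[OF additive_mul_var] additive.add[OF additive_lin_ext]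
          algebra_simps)
  qed
  have E_marked: "?E (single t 1 * b i) \<in> ?V" if i: "i \<in> {1..m}" for t i
  proof (induction t rule: term_induct)
    case zero
    obtain v s where vs: "\<tau> i = tvar v + s" "s \<in> \<O>"
      using \<tau>_in_border[OF i] by (auto simp: border_def)
    have "mul_vars (tvar v + s) - mul_var v (mul_vars s) \<in> ?V" by (rule step)
    moreover have "mul_var v (mul_vars s) = border.tail i"
      using nf_term_border[OF i i] vs by (simp add: mul_vars_in mul_var_single)
    moreover have "?E (single 0 1 * b i) = mul_vars (\<tau> i) - border.tail i"
    proof -
      have "b i = single (\<tau> i) 1 - border.tail i" by (simp add: border.tail_def)
      then show ?thesis
        by (simp add: additive.diff[OF additive_lin_ext] lin_ext_single E_reduced[OF border.keys_tail'[OF i]])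
    qed
    ultimately show ?case using vs by simp
  next
    case (tvar v t)
    have "?E (single (tvar v) 1 * (single t 1 * b i)) - mul_var v (?E (single t 1 * b i)) \<in> ?V"
      by (rule E_step)
    from coeff_module.subspace_add[OF V this mul_var_V[OF tvar.IH, of v]]
    show ?case by (simp add: single_times_single_times)
  qed
  have E_span: "?E q \<in> ?V" if "q \<in> ring_module.span (b ` {1..m})" for q
    by (rule lin_ext_span_mem[OF V _ that]) (use E_marked in blast)
  have "?E p - ?E (p - border.nf p) \<in> ?V"
    by (intro coeff_module.subspace_diff[OF V] E_span p border.diff_nf_in_span)
  then show ?thesis
    by (simp add: additive.diff[OF additive_lin_ext] E_reduced[OF border.keys_nf])
qed

end

section \<open>The ideals of the two marked schemes\<close>

text \<open>
  The polynomials without a term in \<open>\<O>\<close> already form an ideal.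
\<close>

lemma single_in_complement_ideal:
  assumes O: "order_ideal \<O>"
  shows "single t 1 \<in> (complement_ideal \<O> :: ('v, 'k::field) mpoly set) \<longleftrightarrow> t \<notin> \<O>"
proof -
  interpret ring "poly_ring UNIV :: ('v, 'k) mpoly ring" by (rule ring_poly_ring)
  let ?A = "{p :: ('v, 'k) mpoly. keys p \<inter> \<O> = {}}"
  let ?G = "{single t (1::'k) | t. t \<notin> \<O>}"
  have "ideal ?A (poly_ring UNIV)"
  proof (rule poly_ring_idealI)
    show "p + q \<in> ?A" if "p \<in> ?A" "q \<in> ?A" for p q
      using that Poly_Mapping.keys_add[of p q] by blast
    show "r * p \<in> ?A" if "p \<in> ?A" for r p
    proof -
      have "u \<notin> \<O>" if u: "u \<in> keys (r * p)" for u
      proof -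
        obtain s t where "u = s + t" "t \<in> keys p" using keys_mult u by blast
        then show ?thesis using \<open>p \<in> ?A\<close> order_ideal_add[OF O] by blast
      qed
      then show ?thesis by blast
    qed
  qed (auto simp: carrier_poly_ring)
  then have "complement_ideal \<O> \<subseteq> ?A"
    unfolding complement_ideal_def by (rule genideal_minimal) auto
  moreover have "?G \<subseteq> complement_ideal \<O>"
    unfolding complement_ideal_def by (rule genideal_self) (auto simp: carrier_poly_ring)
  ultimately show ?thesis by auto
qed

lemma pommaret_basis_eq:
  assumes "order_ideal \<O>"
  shows "pommaret_basis K \<O> = pommaret_terms \<O>"
  unfolding pommaret_basis_def Let_def pommaret_terms_def
  by (simp add: single_in_complement_ideal[OF assms])

locale generic_marked_set = border_terms \<O> \<tau> m
  for \<O> :: "'v::{finite,linorder} monomial set" and \<tau> :: "nat \<Rightarrow> 'v monomial" and m :: nat +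
  fixes \<sigma> :: "nat \<Rightarrow> 'v monomial" and l :: nat and K :: "'k::field itself"
  assumes bij_\<sigma>: "bij_betw \<sigma> {1..l} \<O>"
begin

abbreviation b :: "nat \<Rightarrow> ('v, 'k param_poly) mpoly" where
  "b \<equiv> generic_marked l \<sigma> \<tau>"

lemma generic_tail: "single (\<tau> i) 1 - b i = (\<Sum>j=1..l. single (\<sigma> j) (pvar (i, j)))"
  by (simp add: generic_marked_def)

lemma sum_over_order_ideal:
  fixes p :: "('v, 'k param_poly) mpoly"
  assumes "keys p \<subseteq> \<O>"
  shows "p = (\<Sum>j=1..l. single (\<sigma> j) (lookup p (\<sigma> j)))"
proof -
  have img: "\<sigma> ` {1..l} = \<O>" and inj: "inj_on \<sigma> {1..l}"
    using bij_\<sigma> by (auto simp: bij_betw_def)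
  have "p = (\<Sum>t\<in>keys p. single t (lookup p t))" by (rule poly_mapping_eq_sum_single)
  also have "\<dots> = (\<Sum>t\<in>\<sigma> ` {1..l}. single t (lookup p t))"
    using assms unfolding img[symmetric] by (intro sum.mono_neutral_left) (auto simp: in_keys_iff)
  finally show ?thesis by (simp add: sum.reindex[OF inj])
qed

lemma lookup_generic_tail:
  assumes "j \<in> {1..l}"
  shows "lookup (single (\<tau> i) 1 - b i) (\<sigma> j) = pvar (i, j)"
proof -
  have "lookup (single (\<sigma> k) (pvar (i, k))) (\<sigma> j) = (if k = j then pvar (i, j) else (0::'k param_poly))"
    if "k \<in> {1..l}" for k
    using inj_on_eq_iff[OF bij_betw_imp_inj_on[OF bij_\<sigma>] that assms]
    by (simp add: lookup_single when_def)
  then show ?thesis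
    using assms by (simp add: generic_tail lookup_sum)
qed

lemma keys_generic_tail: "keys (single (\<tau> i) 1 - b i) \<subseteq> \<O>"
proof -
  have "keys (single (\<sigma> j) (pvar (i, j) :: 'k param_poly)) \<subseteq> \<O>" if "j \<in> {1..l}" for j
    using bij_betw_apply[OF bij_\<sigma> that] by simp
  then show ?thesis
    unfolding generic_tail by (intro order_trans[OF keys_sum] UN_least)
qed

end

sublocale generic_marked_set \<subseteq> marked_set \<O> \<tau> m "generic_marked l \<sigma> \<tau> :: nat \<Rightarrow> ('v, 'k param_poly) mpoly"
  by unfold_locales (rule keys_generic_tail)

context generic_marked_set
begin

definition pommaret_parameters :: "(nat \<times> nat) set" where
  "pommaret_parameters = pommaret_index_set \<times> {1..l}"

lemma pommaret_indices_eq: "pommaret_indices TYPE('k) \<O> m \<tau> = pommaret_index_set"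
  by (simp add: pommaret_indices_def pommaret_index_set_def pommaret_basis_eq[OF O])

lemma pommaret_parameters_eq:
  "parameters m l - nonpommaret_parameters TYPE('k) \<O> l m \<tau> = pommaret_parameters"
  using \<tau>_in_border
  by (auto simp: parameters_def nonpommaret_parameters_def pommaret_parameters_def pommaret_index_set_def
      pommaret_basis_eq[OF O])

lemma pommaret_parameters_subset: "pommaret_parameters \<subseteq> parameters m l"
  by (auto simp: parameters_def pommaret_parameters_def pommaret_index_set_def)

definition border_generators :: "'k param_poly set" where
  "border_generators =
    (\<Union>(r, s) \<in> {(r, s). r \<in> {1..m} \<and> s \<in> {1..m} \<and> neighbour_couple (\<tau> r) (\<tau> s)}.
       Poly_Mapping.range (border.nf (S_poly \<tau> b r s)))"

definition pommaret_generators :: "'k param_poly set" where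
  "pommaret_generators =
    (\<Union>(r, s) \<in> {(r, s). r \<in> pommaret_index_set \<and> s \<in> pommaret_index_set \<and> nonmultiplicative_couple (\<tau> r) (\<tau> s)}.
       Poly_Mapping.range (pommaret.nf (S_poly \<tau> b r s)))"

abbreviation "\<BB> \<equiv> (border_scheme_ideal \<O> l \<sigma> m \<tau> :: 'k param_poly set)"
abbreviation "\<PP> \<equiv> (pommaret_scheme_ideal \<O> l \<sigma> m \<tau> :: 'k param_poly set)"
abbreviation "RB \<equiv> (poly_ring (parameters m l) :: 'k param_poly ring)"
abbreviation "RP \<equiv> (poly_ring pommaret_parameters :: 'k param_poly ring)"

lemma border_scheme_ideal_eq: "\<BB> = genideal RB border_generators"
  unfolding border_scheme_ideal_def border_generators_def border.reduced_form_eq_nf ..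

lemma pommaret_scheme_ideal_eq: "\<PP> = genideal RP pommaret_generators"
  unfolding pommaret_scheme_ideal_def pommaret_generators_def Let_def pommaret_indices_eq
    pommaret_parameters_eq pommaret.reduced_form_eq_nf ..

lemma coeffs_generic:
  assumes "{i} \<times> {1..l} \<subseteq> V"
  shows "b i \<in> coeffs_in (carrier (poly_ring V))"
    and "single (\<tau> i) 1 - b i \<in> coeffs_in (carrier (poly_ring V))"
proof -
  have var: "pvar (i, j) \<in> carrier (poly_ring V :: 'k param_poly ring)" if "j \<in> {1..l}" for j
    using assms that by (auto simp: carrier_poly_ring tvar_def)
  show tail: "single (\<tau> i) 1 - b i \<in> coeffs_in (carrier (poly_ring V))"
    unfolding coeffs_in_def generic_tail
    by (auto simp: lookup_sum lookup_single when_def poly_ring_closed var intro!: poly_ring_sum)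
  have "single (\<tau> i) 1 \<in> coeffs_in (carrier (poly_ring V :: 'k param_poly ring))"
    by (simp add: coeffs_in_def lookup_single when_def poly_ring_closed)
  from coeffs_in_diff[OF this tail] show "b i \<in> coeffs_in (carrier (poly_ring V))"
    by simp
qed

lemma coeffs_S_poly:
  assumes "{i, j} \<times> {1..l} \<subseteq> V"
  shows "S_poly \<tau> b i j \<in> coeffs_in (carrier (poly_ring V))"
  unfolding S_poly_def using assms
  by (intro coeffs_in_diff coeffs_in_single_times coeffs_generic poly_ring_closed(1)) auto

lemma coeffs_border_nf:
  assumes "p \<in> coeffs_in (carrier RB)"
  shows "border.nf p \<in> coeffs_in (carrier RB)"
proof (rule border.nf_coeffs_closed[OF _ _ _ _ _ assms])
  show "border.tail i \<in> coeffs_in (carrier RB)" if "i \<in> {1..m}" for i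
    unfolding border.tail_def using that by (intro coeffs_generic) (auto simp: parameters_def)
qed (rule poly_ring_closed; assumption)+

lemma coeffs_pommaret_nf:
  assumes "p \<in> coeffs_in (carrier RP)"
  shows "pommaret.nf p \<in> coeffs_in (carrier RP)"
proof (rule pommaret.nf_coeffs_closed[OF _ _ _ _ _ assms])
  show "pommaret.tail i \<in> coeffs_in (carrier RP)" if "i \<in> pommaret_index_set" for i
    unfolding pommaret.tail_def using that
    by (intro coeffs_generic) (auto simp: pommaret_parameters_def)
qed (rule poly_ring_closed; assumption)+

lemma coeffs_border_S:
  "r \<in> {1..m} \<Longrightarrow> s \<in> {1..m} \<Longrightarrow> border.nf (S_poly \<tau> b r s) \<in> coeffs_in (carrier RB)"
  by (intro coeffs_border_nf coeffs_S_poly) (auto simp: parameters_def)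

lemma coeffs_pommaret_S:
  "r \<in> pommaret_index_set \<Longrightarrow> s \<in> pommaret_index_set \<Longrightarrow> pommaret.nf (S_poly \<tau> b r s) \<in> coeffs_in (carrier RP)"
  by (intro coeffs_pommaret_nf coeffs_S_poly) (auto simp: pommaret_parameters_def)

lemma border_generators_subset_iff:
  assumes "0 \<in> A"
  shows "border_generators \<subseteq> A \<longleftrightarrow> (\<forall>r\<in>{1..m}. \<forall>s\<in>{1..m}. neighbour_couple (\<tau> r) (\<tau> s) \<longrightarrow>
    border.nf (S_poly \<tau> b r s) \<in> coeffs_in A)"
  unfolding range_subset_iff[OF assms, symmetric] border_generators_def by blast

lemma pommaret_generators_subset_iff:
  assumes "0 \<in> A"
  shows "pommaret_generators \<subseteq> A \<longleftrightarrow> (\<forall>r\<in>pommaret_index_set. \<forall>s\<in>pommaret_index_set.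
    nonmultiplicative_couple (\<tau> r) (\<tau> s) \<longrightarrow> pommaret.nf (S_poly \<tau> b r s) \<in> coeffs_in A)"
  unfolding range_subset_iff[OF assms, symmetric] pommaret_generators_def by blast

lemma border_ideal: "ideal \<BB> RB" and border_generators_in: "border_generators \<subseteq> \<BB>"
proof -
  interpret ring RB by (rule ring_poly_ring)
  have "border_generators \<subseteq> carrier RB"
    using coeffs_border_S by (subst border_generators_subset_iff) (simp_all add: poly_ring_closed)
  then show "ideal \<BB> RB" "border_generators \<subseteq> \<BB>"
    unfolding border_scheme_ideal_eq by (rule genideal_ideal, rule genideal_self)
qed

lemma pommaret_ideal: "ideal \<PP> RP" and pommaret_generators_in: "pommaret_generators \<subseteq> \<PP>"
proof -
  interpret ring RP by (rule ring_poly_ring)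
  have "pommaret_generators \<subseteq> carrier RP"
    using coeffs_pommaret_S by (subst pommaret_generators_subset_iff) (simp_all add: poly_ring_closed)
  then show "ideal \<PP> RP" "pommaret_generators \<subseteq> \<PP>"
    unfolding pommaret_scheme_ideal_eq by (rule genideal_ideal, rule genideal_self)
qed

lemma S_poly_in_span:
  "r \<in> IX \<Longrightarrow> s \<in> IX \<Longrightarrow> S_poly \<tau> b r s \<in> ring_module.span (b ` IX)"
  unfolding S_poly_def
  by (intro ring_module.span_diff ring_module.span_scale ring_module.span_base imageI)

text \<open>
  The Pommaret normal form of an S-polynomial is in the ideal of the border marked set and is its own
  border normal form, so the border criterion applies to it.
\<close>

lemma pommaret_subset_border: "\<PP> \<subseteq> \<BB> \<inter> carrier RP"
proof -
  interpret ring RP by (rule ring_poly_ring)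
  note B = poly_ring_idealD[OF border_ideal]
  have "ideal (\<BB> \<inter> carrier RP) RP"
    using B poly_ring_mono[OF pommaret_parameters_subset]
    by (intro poly_ring_idealI) (auto simp: poly_ring_closed)
  moreover have "pommaret_generators \<subseteq> \<BB> \<inter> carrier RP"
  proof (subst pommaret_generators_subset_iff, simp add: B(2) poly_ring_closed, intro ballI impI)
    fix r s assume rs: "r \<in> pommaret_index_set" "s \<in> pommaret_index_set"
    let ?S = "S_poly \<tau> b r s"
    define h where "h = pommaret.nf ?S"
    \<comment> \<open>The retraction onto the ring of all parameters, which makes an ideal of that ring
      accessible to the criterion.\<close>
    define \<psi> where "\<psi> w = (if w \<in> parameters m l then pvar w else 0 :: 'k param_poly)" for w
    have \<psi>_in: "\<psi> w \<in> carrier RB" for w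
      by (auto simp: \<psi>_def carrier_poly_ring tvar_def)
    have \<psi>_self: "substitute \<psi> f = f" if "f \<in> carrier RB" for f
      by (rule substitute_self[OF _ that]) (simp add: \<psi>_def)
    let ?I = "{f. substitute \<psi> f \<in> \<BB>}"
    have I: "ring_module.subspace ?I"
      by (rule subspace_substitute_preimage[OF border_ideal \<psi>_in])
    have "\<BB> \<subseteq> ?I" using \<psi>_self B(1) by auto
    then have "border_generators \<subseteq> ?I" using border_generators_in by blast
    then have S: "border.nf (S_poly \<tau> b i j) \<in> coeffs_in ?I"
      if "i \<in> {1..m}" "j \<in> {1..m}" "neighbour_couple (\<tau> i) (\<tau> j)" for i j
      using that border_generators_subset_iff[OF ring_module.subspace_0[OF I]] by blast
    have sub: "b ` pommaret_index_set \<subseteq> b ` {1..m}" using pommaret_index_setD(1) by blast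
    have "?S - (?S - h) \<in> ring_module.span (b ` pommaret_index_set)"
      unfolding h_def by (intro ring_module.span_diff S_poly_in_span rs pommaret.diff_nf_in_span)
    then have "h \<in> ring_module.span (b ` {1..m})"
      using ring_module.span_mono[OF sub] by auto
    then have "border.nf h \<in> coeffs_in ?I"
      by (rule border_criterion[OF I, rotated]) (rule S)
    then have "h \<in> coeffs_in ?I"
      unfolding h_def by (simp add: border.nf_reduced[OF pommaret.keys_nf])
    moreover have "h \<in> coeffs_in (carrier RP)"
      unfolding h_def by (rule coeffs_pommaret_S[OF rs])
    ultimately have "substitute \<psi> (lookup h t) \<in> \<BB>" and "lookup h t \<in> carrier RP" for t
      by (simp_all add: coeffs_in_def)
    then show "pommaret.nf ?S \<in> coeffs_in (\<BB> \<inter> carrier RP)"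
      using \<psi>_self[OF subsetD[OF poly_ring_mono[OF pommaret_parameters_subset]]]
      by (simp add: coeffs_in_def flip: h_def)
  qed
  ultimately show ?thesis
    unfolding pommaret_scheme_ideal_eq by (rule genideal_minimal)
qed

text \<open>
  When the elements of the ideal of the Pommaret marked set all have normal form zero, the only
  polynomial in that ideal with head term \<open>\<tau> i\<close> and tail supported on \<open>\<O>\<close> is
  \<open>\<tau> i - nf (\<tau> i)\<close>. The coefficients of its tail are polynomials in the Pommaret parameters.
\<close>

definition reconstruct :: "nat \<times> nat \<Rightarrow> 'k param_poly" where
  "reconstruct = (\<lambda>(i, j). if (i, j) \<in> parameters m l
     then lookup (pommaret.nf (single (\<tau> i) 1)) (\<sigma> j) else 0)"

lemma reconstruct_in: "reconstruct w \<in> carrier RP"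
proof -
  have "single (\<tau> i) 1 \<in> coeffs_in (carrier RP)" for i
    by (simp add: coeffs_in_def lookup_single when_def poly_ring_closed)
  from coeffs_pommaret_nf[OF this] show ?thesis
    by (auto simp: reconstruct_def coeffs_in_def poly_ring_closed split: prod.splits)
qed

lemma reconstruct_self:
  assumes "f \<in> carrier RP"
  shows "substitute reconstruct f = f"
proof (rule substitute_self[OF _ assms])
  fix w assume w: "w \<in> pommaret_parameters"
  then obtain i j where ij: "w = (i, j)" "i \<in> pommaret_index_set" "j \<in> {1..l}"
    by (auto simp: pommaret_parameters_def)
  have "0 \<in> pommaret_mult (\<tau> i)" by (simp add: pommaret_mult_def)
  then have "pommaret.nf (single (\<tau> i) 1) = single (\<tau> i) 1 - b i"
    unfolding pommaret.nf_monomial pommaret.tail_def[symmetric]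
    by (rule pommaret.nf_term_head[OF ij(2)])
  then show "reconstruct w = pvar w"
    using w pommaret_parameters_subset lookup_generic_tail[OF ij(3)]
    by (auto simp: reconstruct_def ij(1))
qed

lemma map_coeffs_reconstruct:
  assumes i: "i \<in> {1..m}"
  shows "map_coeffs (substitute reconstruct) (b i) = single (\<tau> i) 1 - pommaret.nf (single (\<tau> i) 1)"
proof -
  let ?\<Phi> = "map_coeffs (substitute reconstruct) :: ('v, 'k param_poly) mpoly \<Rightarrow> _"
  note \<Phi> = additive_map_coeffs[OF additive_substitute, of reconstruct]
  have "?\<Phi> (single (\<tau> i) 1 - b i) = (\<Sum>j=1..l. single (\<sigma> j) (reconstruct (i, j)))"
    unfolding generic_tail by (simp add: additive.sum[OF \<Phi>] map_coeffs_single[OF additive_substitute])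
  also have "\<dots> = (\<Sum>j=1..l. single (\<sigma> j) (lookup (pommaret.nf (single (\<tau> i) 1)) (\<sigma> j)))"
    by (rule sum.cong) (use i in \<open>simp_all add: reconstruct_def parameters_def\<close>)
  also have "\<dots> = pommaret.nf (single (\<tau> i) 1)"
    by (rule sum_over_order_ideal[OF pommaret.keys_nf, symmetric])
  finally show ?thesis
    by (simp add: additive.diff[OF \<Phi>] map_coeffs_single[OF additive_substitute] algebra_simps)
qed

lemma map_coeffs_span:
  assumes "p \<in> ring_module.span (b ` {1..m})"
  shows "map_coeffs (substitute reconstruct) p \<in> ring_module.span (b ` pommaret_index_set)"
  using assms
proof (induction rule: ring_module.span_induct)
  note \<Phi> = additive_map_coeffs[OF additive_substitute, of reconstruct]
  case base
  show ?case
    by (rule ring_module.subspaceI)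
      (auto simp: additive.zero[OF \<Phi>] additive.add[OF \<Phi>]
        map_coeffs_mult[OF additive_substitute substitute_mult]
        intro: ring_module.span_zero ring_module.span_add ring_module.span_scale)
next
  case (step x)
  then show ?case
    using map_coeffs_reconstruct pommaret.diff_nf_in_span by auto
qed

text \<open>
  The substitution maps \<open>(b)\<close> into the ideal of the Pommaret marked set. Border normal forms of
  S-polynomials are mapped to polynomials that are supported on \<open>\<O>\<close>, and the Pommaret criterion applies
  to these.
\<close>

lemma border_subset_preimage:
  assumes "f \<in> \<BB>"
  shows "substitute reconstruct f \<in> \<PP>"
proof -
  interpret ring RB by (rule ring_poly_ring)
  note P = poly_ring_idealD[OF pommaret_ideal]
  let ?I = "{f. substitute reconstruct f \<in> \<PP>}"
  have I: "ring_module.subspace ?I"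
    by (rule subspace_substitute_preimage[OF pommaret_ideal reconstruct_in])
  have "\<PP> \<subseteq> ?I" using reconstruct_self P(1) by auto
  then have "pommaret_generators \<subseteq> ?I" using pommaret_generators_in by blast
  then have S: "pommaret.nf (S_poly \<tau> b i j) \<in> coeffs_in ?I"
    if "i \<in> pommaret_index_set" "j \<in> pommaret_index_set" "nonmultiplicative_couple (\<tau> i) (\<tau> j)" for i j
    using that pommaret_generators_subset_iff[OF ring_module.subspace_0[OF I]] by blast
  have "ideal (carrier RB \<inter> ?I) RB"
    by (rule poly_ring_idealI)
      (auto simp: poly_ring_closed ring_module.subspace_0[OF I, simplified]
        ring_module.subspace_add[OF I, simplified] ring_module.subspace_scale[OF I, simplified])
  moreover have "border_generators \<subseteq> carrier RB \<inter> ?I"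
  proof (subst border_generators_subset_iff,
      simp add: poly_ring_closed ring_module.subspace_0[OF I, simplified], intro ballI impI)
    fix r s assume rs: "r \<in> {1..m}" "s \<in> {1..m}"
    let ?S = "S_poly \<tau> b r s"
    define h where "h = border.nf ?S"
    let ?\<Phi>h = "map_coeffs (substitute reconstruct) h"
    have "?S - (?S - h) \<in> ring_module.span (b ` {1..m})"
      unfolding h_def by (intro ring_module.span_diff S_poly_in_span rs border.diff_nf_in_span)
    then have "?\<Phi>h \<in> ring_module.span (b ` pommaret_index_set)"
      by (intro map_coeffs_span) simp
    then have "pommaret.nf ?\<Phi>h \<in> coeffs_in ?I"
      by (rule pommaret_criterion[OF I, rotated]) (rule S)
    moreover have "keys ?\<Phi>h \<subseteq> \<O>"
      using keys_map_coeffs[OF additive_substitute] border.keys_nf unfolding h_def by blast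
    ultimately have "?\<Phi>h \<in> coeffs_in ?I"
      by (simp add: pommaret.nf_reduced)
    then have "substitute reconstruct (substitute reconstruct (lookup h t)) \<in> \<PP>" for t
      by (simp add: coeffs_in_def lookup_map_coeffs[OF additive_substitute])
    \<comment> \<open>The criterion yields coefficients that are substituted twice; the substitution is idempotent.\<close>
    then have "h \<in> coeffs_in ?I"
      by (simp add: coeffs_in_def reconstruct_self[OF substitute_in_poly_ring[OF reconstruct_in]])
    moreover have "h \<in> coeffs_in (carrier RB)"
      unfolding h_def by (rule coeffs_border_S[OF rs])
    ultimately show "border.nf ?S \<in> coeffs_in (carrier RB \<inter> ?I)"
      by (simp add: coeffs_in_def h_def)
  qed
  ultimately have "\<BB> \<subseteq> carrier RB \<inter> ?I"
    unfolding border_scheme_ideal_eq by (rule genideal_minimal)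
  then show ?thesis using assms by blast
qed

theorem pommaret_eq_border: "\<PP> = \<BB> \<inter> carrier RP"
proof
  show "\<PP> \<subseteq> \<BB> \<inter> carrier RP" by (rule pommaret_subset_border)
  show "\<BB> \<inter> carrier RP \<subseteq> \<PP>"
    using border_subset_preimage reconstruct_self by (metis IntE subsetI)
qed

end

theorem corollary4p2:
  fixes \<O> :: "'v::{finite, linorder} monomial set"
    and \<sigma> \<tau> :: "nat \<Rightarrow> 'v monomial"
    and l m :: nat
  assumes "order_ideal \<O>"
    and "finite \<O>"
    and "bij_betw \<sigma> {1..l} \<O>"
    and "bij_betw \<tau> {1..m} (border \<O>)"
    and "\<forall>i\<in>{1..m}. \<forall>j\<in>{1..m}. i \<le> j \<longrightarrow> tdeg (\<tau> i) \<le> tdeg (\<tau> j)"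
  shows "(pommaret_scheme_ideal \<O> l \<sigma> m \<tau> :: 'k::field param_poly set) =
    border_scheme_ideal \<O> l \<sigma> m \<tau> \<inter>
      carrier (poly_ring (parameters m l - nonpommaret_parameters TYPE('k) \<O> l m \<tau>))"
proof -
  interpret generic_marked_set \<O> \<tau> m \<sigma> l "TYPE('k)"
    using assms by unfold_locales auto
  show ?thesis
    unfolding pommaret_parameters_eq by (rule pommaret_eq_border)
qed

end
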